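(* Let $G$ be a graph with $n$ vertices $x_1,\ldots,x_n$, let $\mathbb{K}$ be a field, let $S=\mathbb{K}[x_1,\ldots,x_n]$, and let $J(G)\subset S$ be the cover ideal of $G$. Suppose that $s\geq 1$ is the largest integer such that $s\text{-ord-match}(G)=\text{ord-match}(G)$, where $s\text{-ord-match}(G)$ is the $s$-ordered matching number of $G$ and $\text{ord-match}(G)$ is the ordered matching number of $G$. (i) If $s=1$, then for every integer $k$ with $k\geq 2\,\text{ord-match}(G)-1$, we have $\operatorname{depth}(S/J(G)^{(k)})=n-\text{ord-match}(G)-1$. (ii) If $s\geq 2$, then for every integer $k$ with $k\geq 2\,\text{ord-match}(G)-2s+2$, we have $\operatorname{depth}(S/J(G)^{(k)})=n-\text{ord-match}(G)-1$.
   Context: Graphs are finite and simple; the vertices of $G$ are identified with the variables of $S$. A subset of $V(G)$ is independent if no edge of $G$ joins two of its elements. A matching in $G$ is a set of pairwise disjoint edges. Ordered matching: a nonempty matching $M=\{\{a_i,b_i\}\mid 1\leq i\leq r\}$ of $G$ (with the edges indexed and the endpoints named as shown) is an ordered matching of $G$ if (1) $\{a_1,\ldots,a_r\}$ is an independent subset of $G$; and (2) $\{a_i,b_j\}\in E(G)$ implies $i\leq j$. The ordered matching number $\text{ord-match}(G)$ is the maximum of $|M|$ over all ordered matchings $M$ of $G$ (so it presupposes that $G$ has at least one edge). $s$-ordered matching: for an integer $s\geq 1$, a nonempty matching $M=\{\{a_i,b_i\}\mid 1\leq i\leq r\}$ of $G$ is an $s$-ordered matching of $G$ if (1) $r\geq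 s$; (2) $\{a_1,\ldots,a_r\}$ is an independent subset of $G$; and (3) $\{a_i,b_j\}\in E(G)$ implies that either $i=j$ or $i\leq j-s$. The $s$-ordered matching number $s\text{-ord-match}(G)$ is the maximum of $|M|$ over all $s$-ordered matchings $M$ of $G$, and it is $-\infty$ if $G$ has no $s$-ordered matching. (A $1$-ordered matching is the same as an ordered matching.) The cover ideal of $G$ is $J(G)=\bigcap_{\{x_i,x_j\}\in E(G)}(x_i,x_j)\subset S$. For an ideal $I\subset S$ and an integer $k\geq 1$, the $k$-th symbolic power is $I^{(k)}=\bigcap_{\mathfrak{p}\in\operatorname{Min}(I)}\operatorname{Ker}(S\to (S/I^k)_{\mathfrak{p}})$, where $\operatorname{Min}(I)$ is the set of minimal primes of $I$; in particular $J(G)^{(k)}=\bigcap_{\{x_i,x_j\}\in E(G)}(x_i,x_j)^k$. Depth is taken with respect to the graded maximal ideal of $S$. *)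

theory Defs
  imports
    "HOL-Algebra.Algebra"
    "HOL-Library.Poly_Mapping"
    "HOL-Library.Extended_Nat"
    "HOL-Library.Extended_Real"
begin

section \<open>Graphs and ordered matchings\<close>

text \<open>The vertex set is the whole (finite) type \<open>'v\<close>; a graph is given by its edge set.
  Isolated vertices are allowed.\<close>

definition simple_graph :: "'v::finite set set \<Rightarrow> bool" where
  "simple_graph E \<longleftrightarrow> (\<forall>e\<in>E. card e = 2)"

definition independent :: "'v set set \<Rightarrow> 'v set \<Rightarrow> bool" where
  "independent E A \<longleftrightarrow> (\<forall>x\<in>A. \<forall>y\<in>A. {x, y} \<notin> E)"

definition matching :: "'v set set \<Rightarrow> 'v set set \<Rightarrow> bool" where
  "matching E M \<longleftrightarrow> M \<subseteq> E \<and> pairwise disjnt M"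

text \<open>\<open>a\<close>, \<open>b\<close> and \<open>r\<close> enumerate the edges of \<open>M\<close> as \<open>{a i, b i}\<close> for \<open>i = 1, \<dots>, r\<close>,
  without repetition.\<close>

definition indexes_matching ::
    "'v set set \<Rightarrow> (nat \<Rightarrow> 'v) \<Rightarrow> (nat \<Rightarrow> 'v) \<Rightarrow> nat \<Rightarrow> bool" where
  "indexes_matching M a b r \<longleftrightarrow> bij_betw (\<lambda>i. {a i, b i}) {1..r} M"

definition ordered_matching :: "'v set set \<Rightarrow> 'v set set \<Rightarrow> bool" where
  "ordered_matching E M \<longleftrightarrow>
     M \<noteq> {} \<and> matching E M \<and>
     (\<exists>a b r. indexes_matching M a b r \<and>
        independent E (a ` {1..r}) \<and>
        (\<forall>i\<in>{1..r}. \<forall>j\<in>{1..r}. {a i, b j} \<in> E \<longrightarrow> i \<le> j))"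

text \<open>The condition \<open>i \<le> j - s\<close> is written \<open>i + s \<le> j\<close> to avoid truncated subtraction.\<close>

definition s_ordered_matching :: "nat \<Rightarrow> 'v set set \<Rightarrow> 'v set set \<Rightarrow> bool" where
  "s_ordered_matching s E M \<longleftrightarrow>
     M \<noteq> {} \<and> matching E M \<and>
     (\<exists>a b r. indexes_matching M a b r \<and>
        s \<le> r \<and>
        independent E (a ` {1..r}) \<and>
        (\<forall>i\<in>{1..r}. \<forall>j\<in>{1..r}. {a i, b j} \<in> E \<longrightarrow> i = j \<or> i + s \<le> j))"

text \<open>Only meaningful if \<open>E\<close> is nonempty.\<close>

definition ord_match :: "'v::finite set set \<Rightarrow> nat" where
  "ord_match E = Max {card M | M. ordered_matching E M}"

definition s_ord_match :: "nat \<Rightarrow> 'v::finite set set \<Rightarrow> ereal" where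
  "s_ord_match s E =
     (if \<exists>M. s_ordered_matching s E M
      then ereal (real (Max {card M | M. s_ordered_matching s E M}))
      else - \<infinity>)"


section \<open>Quotient modules, symbolic powers and depth\<close>

text \<open>The quotient \<open>R / I\<close> as an \<open>R\<close>-module.\<close>

definition quot_module ::
    "('a, 'c) ring_scheme \<Rightarrow> 'a set \<Rightarrow> ('a, 'a set) module" where
  "quot_module R I =
     \<lparr>carrier = carrier (R Quot I),
      monoid.mult = monoid.mult (R Quot I), monoid.one = monoid.one (R Quot I),
      ring.zero = ring.zero (R Quot I), ring.add = ring.add (R Quot I),
      smult = (\<lambda>r C. (I +>\<^bsub>R\<^esub> r) \<otimes>\<^bsub>R Quot I\<^esub> C)\<rparr>"

text \<open>The localization of \<open>M\<close> at a multiplicative set \<open>U\<close> consists of the classes of this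
  equivalence relation on fractions \<open>x/u\<close>, coded as pairs \<open>(x, u)\<close>.\<close>

definition frac_rel ::
    "('a, 'c) ring_scheme \<Rightarrow> ('a, 'b, 'd) module_scheme \<Rightarrow> 'a set \<Rightarrow>
     (('b \<times> 'a) \<times> ('b \<times> 'a)) set" where
  "frac_rel R M U =
     {((x, u), (y, v)). x \<in> carrier M \<and> u \<in> U \<and> y \<in> carrier M \<and> v \<in> U \<and>
        (\<exists>w\<in>U. w \<odot>\<^bsub>M\<^esub> (v \<odot>\<^bsub>M\<^esub> x) = w \<odot>\<^bsub>M\<^esub> (u \<odot>\<^bsub>M\<^esub> y))}"

definition to_localization ::
    "('a, 'c) ring_scheme \<Rightarrow> ('a, 'b, 'd) module_scheme \<Rightarrow> 'a set \<Rightarrow> 'b \<Rightarrow> ('b \<times> 'a) set" where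
  "to_localization R M U x = frac_rel R M U `` {(x, \<one>\<^bsub>R\<^esub>)}"

definition minimal_primes :: "('a, 'c) ring_scheme \<Rightarrow> 'a set \<Rightarrow> 'a set set" where
  "minimal_primes R I =
     {P. primeideal P R \<and> I \<subseteq> P \<and> (\<forall>Q. primeideal Q R \<and> I \<subseteq> Q \<and> Q \<subseteq> P \<longrightarrow> Q = P)}"

text \<open>The kernel of \<open>R \<rightarrow> (R / I)\<^sub>P\<close> for a prime ideal \<open>P\<close>.\<close>

definition localization_kernel :: "('a, 'c) ring_scheme \<Rightarrow> 'a set \<Rightarrow> 'a set \<Rightarrow> 'a set" where
  "localization_kernel R I P =
     {f \<in> carrier R.
        to_localization R (quot_module R I) (carrier R - P) (I +>\<^bsub>R\<^esub> f) =
        to_localization R (quot_module R I) (carrier R - P) \<zero>\<^bsub>quot_module R I\<^esub>}"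

text \<open>Ideal powers are powers in the monoid \<^const>\<open>ideals_set\<close> of ideals under
  multiplication. The intersection is taken inside \<open>R\<close>, which matters only if there are no
  minimal primes.\<close>

definition symbolic_power :: "('a, 'c) ring_scheme \<Rightarrow> 'a set \<Rightarrow> nat \<Rightarrow> 'a set" where
  "symbolic_power R I k =
     carrier R \<inter>
     (\<Inter>P\<in>minimal_primes R I. localization_kernel R (I [^]\<^bsub>ideals_set R\<^esub> k) P)"

text \<open>The submodule \<open>(f\<^sub>1, \<dots>, f\<^sub>m) M\<close> of \<open>M\<close>.\<close>

definition seq_submodule ::
    "('a, 'c) ring_scheme \<Rightarrow> ('a, 'b, 'd) module_scheme \<Rightarrow> 'a list \<Rightarrow> 'b set" where
  "seq_submodule R M fs =
     \<Inter>{N. submodule N R M \<and> (\<forall>f\<in>set fs. \<forall>x\<in>carrier M. f \<odot>\<^bsub>M\<^esub> x \<in> N)}"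

text \<open>\<open>f\<^sub>i\<close> is a nonzerodivisor on \<open>M / (f\<^sub>1, \<dots>, f\<^sub>i\<^sub>-\<^sub>1) M\<close>, and \<open>(f\<^sub>1, \<dots>, f\<^sub>m) M \<noteq> M\<close>.\<close>

definition regular_sequence ::
    "('a, 'c) ring_scheme \<Rightarrow> ('a, 'b, 'd) module_scheme \<Rightarrow> 'a list \<Rightarrow> bool" where
  "regular_sequence R M fs \<longleftrightarrow>
     set fs \<subseteq> carrier R \<and>
     (\<forall>i<length fs. \<forall>x\<in>carrier M.
        (fs ! i) \<odot>\<^bsub>M\<^esub> x \<in> seq_submodule R M (take i fs) \<longrightarrow>
        x \<in> seq_submodule R M (take i fs)) \<and>
     seq_submodule R M fs \<noteq> carrier M"

text \<open>Depth of \<open>M\<close> with respect to an ideal \<open>I\<close>: the supremum of the lengths of \<open>M\<close>-regular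
  sequences in \<open>I\<close>, and \<open>\<infinity>\<close> for the zero module.\<close>

definition depth ::
    "('a, 'c) ring_scheme \<Rightarrow> 'a set \<Rightarrow> ('a, 'b, 'd) module_scheme \<Rightarrow> enat" where
  "depth R I M =
     (if carrier M = {\<zero>\<^bsub>M\<^esub>} then \<infinity>
      else (SUP fs\<in>{fs. regular_sequence R M fs \<and> set fs \<subseteq> I}. enat (length fs)))"


section \<open>The polynomial ring and cover ideals\<close>

text \<open>Polynomials over \<open>'k\<close> in the variables \<open>'v\<close>: finitely supported functions from exponent
  vectors to coefficients, with the multiplication of \<^type>\<open>poly_mapping\<close>.\<close>

type_synonym ('v, 'k) mpoly = "('v \<Rightarrow>\<^sub>0 nat) \<Rightarrow>\<^sub>0 'k"

definition mpoly_ring :: "('v, 'k::field) mpoly ring" where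
  "mpoly_ring = \<lparr>carrier = UNIV, monoid.mult = (*), monoid.one = 1, ring.zero = 0, ring.add = (+)\<rparr>"

definition mpoly_var :: "'v \<Rightarrow> ('v, 'k::field) mpoly" where
  "mpoly_var x = Poly_Mapping.single (Poly_Mapping.single x 1) 1"

definition graded_maximal_ideal :: "('v, 'k::field) mpoly set" where
  "graded_maximal_ideal = genideal mpoly_ring (range mpoly_var)"

definition cover_ideal :: "'v::finite set set \<Rightarrow> ('v, 'k::field) mpoly set" where
  "cover_ideal E = (\<Inter>e\<in>E. genideal mpoly_ring (mpoly_var ` e))"

end

theory Submission
  imports Defs
begin

text \<open>The symbolic power \<open>J\<^sup>(\<^sup>k\<^sup>)\<close> is spanned by the monomials \<open>x\<^sup>b\<close> with \<open>b\<^sub>i + b\<^sub>j \<ge> k\<close> on all edges. Let \<open>r\<close> be the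
  ordered matching number.

  Lower bound: if a sequence is regular modulo \<open>L : u\<close> and modulo \<open>L + (u)\<close>, it is regular modulo \<open>L\<close>.
  Repeated use of this with monomials \<open>u\<close> reduces \<open>J\<^sup>(\<^sup>k\<^sup>)\<close> to ideals generated by at most \<open>r + 1\<close> variables.
  Modulo all of those the elementary symmetric polynomials \<open>e\<^sub>1, \<dots>, e\<^sub>t\<close> with \<open>t = n - r - 1\<close> are regular.

  Upper bound: a nonzero class in the \<open>d\<close>-th Koszul cohomology modulo \<open>L\<close> yields one of degree \<open>d - 1\<close> modulo
  \<open>L + (f)\<close> for every nonzerodivisor \<open>f\<close> in the ideal of the Koszul complex, and there is none in degree
  \<open>0\<close>, so regular sequences have length at most \<open>d\<close>. For large \<open>k\<close> an \<open>s\<close>-ordered matching of size \<open>r\<close>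
  provides an exponent vector at which exactly its own edges have degree below \<open>k\<close>. From it one
  writes down a class of degree \<open>n - r - 1\<close>.\<close>

section \<open>Weakly regular sequences modulo ideals\<close>

text \<open>Passing to \<open>L : u\<close> and \<open>L + (u)\<close> requires one and the same
  sequence on both sides, so it has to be fixed in advance and be regular modulo every ideal of at
  most r + 1 variables. General linear forms achieve this only over a large enough field. Elementary
  symmetric polynomials achieve it over every field, because modulo all but i of the variables e_i
  becomes a product of variables.

  The length n - r - 1 has two sources. From below, each variable adjoined in the reduction is an
  endpoint of a further edge of an ordered matching, so at most r are adjoined, and a leftover
  monomial generator costs one more. From above, the cocycle is a product of r - 1 forms, one for
  each matched edge but the last, and of n - 2 r forms, one for each unmatched vertex.

  Depth is a supremum over all regular sequences, so the upper bound has to handle an arbitrary one;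
  an explicit contraction of cochains takes the place of a long exact sequence.\<close>

definition is_ideal :: "'a::comm_ring_1 set \<Rightarrow> bool" where
  "is_ideal L \<longleftrightarrow> 0 \<in> L \<and> (\<forall>a\<in>L. \<forall>b\<in>L. a + b \<in> L) \<and> (\<forall>r. \<forall>a\<in>L. r * a \<in> L)"

definition ideal_extend :: "'a::comm_ring_1 set \<Rightarrow> 'a \<Rightarrow> 'a set" where
  "ideal_extend L f = {a + r * f | a r. a \<in> L}"

definition ideal_colon :: "'a::comm_ring_1 set \<Rightarrow> 'a \<Rightarrow> 'a set" where
  "ideal_colon L u = {g. g * u \<in> L}"

definition nzd :: "'a::comm_ring_1 set \<Rightarrow> 'a \<Rightarrow> bool" where
  "nzd L f \<longleftrightarrow> (\<forall>g. f * g \<in> L \<longrightarrow> g \<in> L)"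

text \<open>Properness of the final ideal is left out, because colons may reach the whole ring,
  where every sequence qualifies. It returns in \<open>regular_sequence_quot_iff\<close>.\<close>

primrec weakly_regular :: "'a::comm_ring_1 set \<Rightarrow> 'a list \<Rightarrow> bool" where
  "weakly_regular L [] \<longleftrightarrow> True"
| "weakly_regular L (f # fs) \<longleftrightarrow> nzd L f \<and> weakly_regular (ideal_extend L f) fs"

lemma is_idealI:
  assumes "0 \<in> L" "\<And>a b. a \<in> L \<Longrightarrow> b \<in> L \<Longrightarrow> a + b \<in> L" "\<And>r a. a \<in> L \<Longrightarrow> r * a \<in> L"
  shows "is_ideal L"
  using assms by (auto simp: is_ideal_def)

lemma ideal_zero: "is_ideal L \<Longrightarrow> 0 \<in> L"
  and ideal_add: "is_ideal L \<Longrightarrow> a \<in> L \<Longrightarrow> b \<in> L \<Longrightarrow> a + b \<in> L"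
  and ideal_mult: "is_ideal L \<Longrightarrow> a \<in> L \<Longrightarrow> r * a \<in> L"
  by (auto simp: is_ideal_def)

lemma ideal_mult_right: "is_ideal L \<Longrightarrow> a \<in> L \<Longrightarrow> a * r \<in> L"
  by (metis ideal_mult mult.commute)

lemma ideal_uminus: "is_ideal L \<Longrightarrow> a \<in> L \<Longrightarrow> - a \<in> L"
  by (metis ideal_mult mult_minus1)

lemma ideal_diff: "is_ideal L \<Longrightarrow> a \<in> L \<Longrightarrow> b \<in> L \<Longrightarrow> a - b \<in> L"
  by (metis ideal_add ideal_uminus diff_conv_add_uminus)

lemma ideal_sum: "is_ideal L \<Longrightarrow> (\<And>x. x \<in> Y \<Longrightarrow> f x \<in> L) \<Longrightarrow> sum f Y \<in> L"
  by (induction Y rule: infinite_finite_induct) (auto simp: ideal_zero ideal_add)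

lemma ideal_diff_mem_iff: "is_ideal L \<Longrightarrow> a - b \<in> L \<Longrightarrow> a \<in> L \<longleftrightarrow> b \<in> L"
  using ideal_add[of L "a - b" b] ideal_diff[of L a "a - b"] by auto

lemma ideal_eq_UNIV: "is_ideal L \<Longrightarrow> 1 \<in> L \<Longrightarrow> L = UNIV"
  by (metis UNIV_eq_I ideal_mult mult.right_neutral)

lemma is_ideal_UNIV: "is_ideal UNIV"
  by (simp add: is_ideal_def)

lemma ideal_extend_is_ideal:
  assumes "is_ideal L"
  shows "is_ideal (ideal_extend L f)"
proof (rule is_idealI)
  show "0 \<in> ideal_extend L f"
    using ideal_zero[OF assms] unfolding ideal_extend_def
    by (intro CollectI exI[of _ 0]) simp
next
  fix a b assume "a \<in> ideal_extend L f" "b \<in> ideal_extend L f"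
  then obtain a' r b' s where "a' \<in> L" "a = a' + r * f" "b' \<in> L" "b = b' + s * f"
    by (auto simp: ideal_extend_def)
  then have "a + b = (a' + b') + (r + s) * f" "a' + b' \<in> L"
    using ideal_add[OF assms] by (simp_all add: algebra_simps)
  then show "a + b \<in> ideal_extend L f" unfolding ideal_extend_def by blast
next
  fix s a assume "a \<in> ideal_extend L f"
  then obtain a' r where "a' \<in> L" "a = a' + r * f" by (auto simp: ideal_extend_def)
  then have "s * a = s * a' + (s * r) * f" "s * a' \<in> L"
    using ideal_mult[OF assms, of a' s] by (simp_all add: algebra_simps)
  then show "s * a \<in> ideal_extend L f" unfolding ideal_extend_def by blast
qed

lemma ideal_extend_iff: "is_ideal L \<Longrightarrow> g \<in> ideal_extend L f \<longleftrightarrow> (\<exists>r. g - r * f \<in> L)"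
proof
  assume "g \<in> ideal_extend L f"
  then obtain a r where "a \<in> L" "g = a + r * f" by (auto simp: ideal_extend_def)
  then have "g - r * f \<in> L" by simp
  then show "\<exists>r. g - r * f \<in> L" ..
next
  assume "\<exists>r. g - r * f \<in> L"
  then obtain r where "g - r * f \<in> L" ..
  then show "g \<in> ideal_extend L f"
    unfolding ideal_extend_def by (intro CollectI exI[of _ "g - r * f"] exI[of _ r]) simp
qed

lemma ideal_extend_superset: "L \<subseteq> ideal_extend L f"
  unfolding ideal_extend_def
proof
  fix a assume "a \<in> L"
  then show "a \<in> {a + r * f |a r. a \<in> L}"
    by (intro CollectI exI[of _ a] exI[of _ 0]) simp
qed

lemma ideal_extend_generator: "is_ideal L \<Longrightarrow> r * f \<in> ideal_extend L f"
  by (simp add: ideal_extend_iff) (metis cancel_comm_monoid_add_class.diff_cancel ideal_zero)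

lemma ideal_extend_least:
  "is_ideal L' \<Longrightarrow> L \<subseteq> L' \<Longrightarrow> f \<in> L' \<Longrightarrow> ideal_extend L f \<subseteq> L'"
  unfolding ideal_extend_def by (blast intro: ideal_add ideal_mult)

lemma ideal_extend_commute:
  "ideal_extend (ideal_extend L f) g = ideal_extend (ideal_extend L g) f"
proof -
  have "ideal_extend (ideal_extend L f) g \<subseteq> ideal_extend (ideal_extend L g) f" for f g :: 'a
  proof
    fix h assume "h \<in> ideal_extend (ideal_extend L f) g"
    then obtain a r s where "a \<in> L" "h = (a + r * f) + s * g" by (auto simp: ideal_extend_def)
    then have "h = (a + s * g) + r * f" by (simp add: algebra_simps)
    moreover have "a + s * g \<in> ideal_extend L g"
      using \<open>a \<in> L\<close> unfolding ideal_extend_def by blast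
    ultimately show "h \<in> ideal_extend (ideal_extend L g) f"
      unfolding ideal_extend_def[of _ f] by blast
  qed
  from this[of f g] this[of g f] show ?thesis by (rule equalityI)
qed

lemma ideal_colon_is_ideal: "is_ideal L \<Longrightarrow> is_ideal (ideal_colon L u)"
  unfolding is_ideal_def ideal_colon_def by (simp add: distrib_right mult.assoc)

lemma nzdD: "nzd L f \<Longrightarrow> f * g \<in> L \<Longrightarrow> g \<in> L"
  unfolding nzd_def by blast

lemma nzd_mult: "nzd L f \<Longrightarrow> nzd L g \<Longrightarrow> nzd L (f * g)"
  unfolding nzd_def mult.assoc by blast

lemma nzd_one: "nzd L 1"
  by (simp add: nzd_def)

lemma nzd_power: "nzd L f \<Longrightarrow> nzd L (f ^ k)"
  by (induction k) (simp_all add: nzd_mult nzd_one)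

lemma nzd_cong_mod:
  assumes "is_ideal L" "f - f' \<in> L" "nzd L f'"
  shows "nzd L f"
  unfolding nzd_def
proof (intro allI impI)
  fix g assume "f * g \<in> L"
  moreover have "f * g - f' * g \<in> L"
    using ideal_mult_right[OF assms(1,2), of g] by (simp add: left_diff_distrib)
  ultimately have "f' * g \<in> L" using ideal_diff_mem_iff[OF assms(1)] by blast
  then show "g \<in> L" by (rule nzdD[OF assms(3)])
qed

lemma weakly_regular_UNIV: "weakly_regular UNIV fs"
proof (induction fs)
  case (Cons f fs)
  have "ideal_extend UNIV f = UNIV" using ideal_extend_superset by blast
  then show ?case using Cons by (simp add: nzd_def)
qed simp

text \<open>The exact sequence of the colon stays exact modulo \<open>f\<close>. If h u = g f modulo
  \<open>L\<close>, then g lies in L + (u), say g = h' u modulo \<open>L\<close>, and (h - h' f) u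
  lies in \<open>L\<close>.\<close>

lemma ideal_colon_extend:
  assumes L: "is_ideal L" and f: "nzd (ideal_extend L u) f"
  shows "ideal_colon (ideal_extend L f) u = ideal_extend (ideal_colon L u) f"
proof (intro equalityI subsetI)
  fix h assume "h \<in> ideal_colon (ideal_extend L f) u"
  then obtain g where g: "h * u - g * f \<in> L"
    using L by (auto simp: ideal_colon_def ideal_extend_iff)
  have "f * g \<in> ideal_extend L u"
  proof -
    have "f * g - h * u \<in> L" using ideal_uminus[OF L g] by (simp add: mult.commute)
    then show ?thesis using L by (auto simp: ideal_extend_iff)
  qed
  then have "g \<in> ideal_extend L u" using nzdD[OF f] by blast
  then obtain h' where h': "g - h' * u \<in> L" using L by (auto simp: ideal_extend_iff)
  have "(h * u - g * f) + f * (g - h' * u) \<in> L"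
    using L g h' by (intro ideal_add ideal_mult)
  then have "h - h' * f \<in> ideal_colon L u"
    by (simp add: ideal_colon_def algebra_simps)
  then show "h \<in> ideal_extend (ideal_colon L u) f"
    using ideal_colon_is_ideal[OF L] by (auto simp: ideal_extend_iff)
next
  fix h assume "h \<in> ideal_extend (ideal_colon L u) f"
  then obtain r where "(h - r * f) * u \<in> L"
    using ideal_colon_is_ideal[OF L] by (auto simp: ideal_extend_iff ideal_colon_def)
  then have "h * u - (r * u) * f \<in> L" by (simp add: algebra_simps)
  then show "h \<in> ideal_colon (ideal_extend L f) u"
    using L by (auto simp: ideal_colon_def ideal_extend_iff)
qed

lemma nzd_colonI:
  assumes L: "is_ideal L" and c: "nzd (ideal_colon L u) f" and e: "nzd (ideal_extend L u) f"
  shows "nzd L f"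
  unfolding nzd_def
proof (intro allI impI)
  fix g assume fg: "f * g \<in> L"
  then have "g \<in> ideal_extend L u"
    using nzdD[OF e] ideal_extend_superset by blast
  then obtain h where h: "g - h * u \<in> L" using L by (auto simp: ideal_extend_iff)
  have "f * g - f * (g - h * u) \<in> L" using ideal_diff[OF L fg ideal_mult[OF L h]] .
  then have "f * h \<in> ideal_colon L u" by (simp add: ideal_colon_def algebra_simps)
  then have "h * u \<in> L" using nzdD[OF c] by (simp add: ideal_colon_def)
  then show "g \<in> L" using ideal_diff_mem_iff[OF L h] by blast
qed

text \<open>This is the long exact sequence argument for
  \<open>0 \<rightarrow> R/(L : u) \<rightarrow> R/L \<rightarrow> R/(L + (u)) \<rightarrow> 0\<close>, made elementary.\<close>

lemma weakly_regular_colonI: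
  assumes "is_ideal L" "weakly_regular (ideal_colon L u) fs" "weakly_regular (ideal_extend L u) fs"
  shows "weakly_regular L fs"
  using assms
proof (induction fs arbitrary: L)
  case (Cons f fs)
  have f: "nzd (ideal_colon L u) f" "nzd (ideal_extend L u) f" using Cons.prems by auto
  have "weakly_regular (ideal_extend L f) fs"
  proof (rule Cons.IH)
    show "is_ideal (ideal_extend L f)" using Cons.prems ideal_extend_is_ideal by blast
    show "weakly_regular (ideal_colon (ideal_extend L f) u) fs"
      using Cons.prems f by (simp add: ideal_colon_extend)
    show "weakly_regular (ideal_extend (ideal_extend L f) u) fs"
      using Cons.prems by (simp add: ideal_extend_commute[of L f])
  qed
  then show ?case using nzd_colonI[OF Cons.prems(1) f] by simp
qed simp

text \<open>The ring modulo \<open>L\<close> and \<open>f ^ k\<close> is filtered by k copies of the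
  ring modulo \<open>L\<close> and \<open>f\<close>: the colon by \<open>f\<close> lowers the
  exponent by one, and adjoining \<open>f\<close> gives back L + (f).\<close>

lemma weakly_regular_power_extend:
  assumes L: "is_ideal L" and f: "nzd L f" and fs: "weakly_regular (ideal_extend L f) fs"
  shows "weakly_regular (ideal_extend L (f ^ k)) fs"
proof (induction k)
  case 0
  have "ideal_extend L (f ^ 0) = UNIV"
    using ideal_extend_generator[OF L, of _ 1] by auto
  then show ?case by (simp add: weakly_regular_UNIV)
next
  case (Suc k)
  let ?L = "ideal_extend L (f ^ Suc k)"
  have i: "is_ideal ?L" by (rule ideal_extend_is_ideal[OF L])
  have "ideal_colon ?L f = ideal_extend L (f ^ k)"
  proof (intro equalityI subsetI)
    fix g assume "g \<in> ideal_colon ?L f"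
    then obtain r where "g * f - r * f ^ Suc k \<in> L"
      using L by (auto simp: ideal_colon_def ideal_extend_iff)
    then have "f * (g - r * f ^ k) \<in> L" by (simp add: algebra_simps)
    then have "g - r * f ^ k \<in> L" using nzdD[OF f] by blast
    then show "g \<in> ideal_extend L (f ^ k)" using L by (auto simp: ideal_extend_iff)
  next
    fix g assume "g \<in> ideal_extend L (f ^ k)"
    then obtain r where "g - r * f ^ k \<in> L" using L by (auto simp: ideal_extend_iff)
    then have "f * (g - r * f ^ k) \<in> L" using L by (auto intro: ideal_mult)
    then have "g * f - r * f ^ Suc k \<in> L" by (simp add: algebra_simps)
    then show "g \<in> ideal_colon ?L f" using L by (auto simp: ideal_colon_def ideal_extend_iff)
  qed
  moreover have "ideal_extend ?L f = ideal_extend L f"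
  proof (rule antisym)
    show "ideal_extend ?L f \<subseteq> ideal_extend L f"
    proof (intro ideal_extend_least ideal_extend_is_ideal[OF L] ideal_extend_superset)
      show "f \<in> ideal_extend L f" using ideal_extend_generator[OF L, of 1] by simp
      then show "f ^ Suc k \<in> ideal_extend L f"
        using ideal_mult_right[OF ideal_extend_is_ideal[OF L]] by simp
    qed
    show "ideal_extend L f \<subseteq> ideal_extend ?L f"
      using ideal_extend_superset[of L "f ^ Suc k"] unfolding ideal_extend_def by blast
  qed
  ultimately show ?case
    using Suc fs i by (intro weakly_regular_colonI[of ?L f]) auto
qed

text \<open>The half of the permutability of a regular sequence y, f that holds without Nakayama's
  lemma. The other half is \<open>graded_nzdI\<close>.\<close>

lemma nzd_extend_swap:
  assumes L: "is_ideal L" and y: "nzd L y" and f: "nzd (ideal_extend L y) f"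
  shows "nzd (ideal_extend L f) y"
  unfolding nzd_def
proof (intro allI impI)
  fix g assume "y * g \<in> ideal_extend L f"
  then obtain h where h: "y * g - h * f \<in> L" using L by (auto simp: ideal_extend_iff)
  have "f * h - g * y \<in> L" using ideal_uminus[OF L h] by (simp add: mult.commute)
  then have "f * h \<in> ideal_extend L y" using L by (auto simp: ideal_extend_iff)
  then have "h \<in> ideal_extend L y" using nzdD[OF f] by blast
  then obtain h' where h': "h - h' * y \<in> L" using L by (auto simp: ideal_extend_iff)
  have "(y * g - h * f) + f * (h - h' * y) \<in> L" using L h h' by (intro ideal_add ideal_mult)
  then have "y * (g - h' * f) \<in> L" by (simp add: algebra_simps)
  then have "g - h' * f \<in> L" using nzdD[OF y] by blast
  then show "g \<in> ideal_extend L f" using L by (auto simp: ideal_extend_iff)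
qed

lemma foldl_extend_is_ideal: "is_ideal L \<Longrightarrow> is_ideal (foldl ideal_extend L fs)"
  by (induction fs arbitrary: L) (auto simp: ideal_extend_is_ideal)

lemma foldl_extend_superset: "L \<subseteq> foldl ideal_extend L fs"
proof (induction fs arbitrary: L)
  case (Cons f fs)
  then show ?case using order_trans[OF ideal_extend_superset[of L f]] by simp
qed simp

lemma foldl_extend_mem: "is_ideal L \<Longrightarrow> f \<in> set fs \<Longrightarrow> f \<in> foldl ideal_extend L fs"
proof (induction fs arbitrary: L)
  case (Cons a fs)
  then show ?case
    using ideal_extend_generator[of L 1 a] foldl_extend_superset[of "ideal_extend L a" fs]
    by (auto simp: ideal_extend_is_ideal)
qed simp

lemma foldl_extend_least:
  "is_ideal L' \<Longrightarrow> L \<subseteq> L' \<Longrightarrow> set fs \<subseteq> L' \<Longrightarrow> foldl ideal_extend L fs \<subseteq> L'"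
  by (induction fs arbitrary: L) (auto simp: ideal_extend_least)

lemma foldl_extend_commute:
  "foldl ideal_extend (ideal_extend L y) fs = ideal_extend (foldl ideal_extend L fs) y"
  by (induction fs arbitrary: L) (auto simp: ideal_extend_commute)

lemma weakly_regular_iff_nth:
  "weakly_regular L fs \<longleftrightarrow> (\<forall>i<length fs. nzd (foldl ideal_extend L (take i fs)) (fs ! i))"
  by (induction fs arbitrary: L) (auto simp: All_less_Suc2)

lemma weakly_regular_append:
  "weakly_regular L (fs @ gs) \<longleftrightarrow> weakly_regular L fs \<and> weakly_regular (foldl ideal_extend L fs) gs"
  by (induction fs arbitrary: L) auto

section \<open>Monomial ideals\<close>

abbreviation lk :: "('a \<Rightarrow>\<^sub>0 'b::zero) \<Rightarrow> 'a \<Rightarrow> 'b" where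
  "lk \<equiv> Poly_Mapping.lookup"

abbreviation mon :: "('v \<Rightarrow>\<^sub>0 nat) \<Rightarrow> ('v, 'k::field) mpoly" where
  "mon b \<equiv> Poly_Mapping.single b 1"

definition expo :: "('v::finite \<Rightarrow> nat) \<Rightarrow> ('v \<Rightarrow>\<^sub>0 nat)" where
  "expo f = Abs_poly_mapping f"

definition mono_dvd :: "('v \<Rightarrow>\<^sub>0 nat) \<Rightarrow> ('v \<Rightarrow>\<^sub>0 nat) \<Rightarrow> bool" where
  "mono_dvd b e \<longleftrightarrow> (\<forall>v. lk b v \<le> lk e v)"

definition upclosed :: "('v \<Rightarrow>\<^sub>0 nat) set \<Rightarrow> bool" where
  "upclosed B \<longleftrightarrow> (\<forall>b\<in>B. \<forall>d. b + d \<in> B)"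

text \<open>For an upclosed \<open>B\<close> this is the ideal spanned by the monomials with
  exponent in \<open>B\<close>. In this encoding, colons by monomials and adjoining monomials are
  set operations on exponents.\<close>

definition mono_ideal :: "('v \<Rightarrow>\<^sub>0 nat) set \<Rightarrow> ('v, 'k::field) mpoly set" where
  "mono_ideal B = {p. Poly_Mapping.keys p \<subseteq> B}"

lemma lk_expo [simp]: "lk (expo f) = f"
  by (simp add: expo_def)

lemma mono_dvd_diff_add: "mono_dvd b e \<Longrightarrow> b + (e - b) = e"
  by (rule poly_mapping_eqI) (simp add: mono_dvd_def lookup_add lookup_minus)

lemma mono_dvd_add: "mono_dvd b (b + d)"
  by (simp add: mono_dvd_def lookup_add)

lemma mono_dvd_iff: "mono_dvd b e \<longleftrightarrow> (\<exists>d. e = b + d)"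
  by (metis mono_dvd_add mono_dvd_diff_add)

lemma lookup_single_mult:
  fixes p :: "('v, 'k::field) mpoly"
  shows "lk (Poly_Mapping.single b c * p) e = (if mono_dvd b e then c * lk p (e - b) else 0)"
proof -
  have eq: "e = b + q \<longleftrightarrow> mono_dvd b e \<and> q = e - b" for q
    using mono_dvd_diff_add[of b e] mono_dvd_add[of b q] by auto
  have "lk (Poly_Mapping.single b c * p) e = c * (\<Sum>q. lk p q when e = b + q)"
    unfolding lookup_mult lookup_single when_mult
    by (subst Sum_any_when_equal') simp
  also have "\<dots> = (if mono_dvd b e then c * lk p (e - b) else 0)"
    unfolding eq by simp
  finally show ?thesis .
qed

lemma lookup_mon_mult_add: "lk (mon b * p) (b + d) = lk p d"
  by (simp add: lookup_single_mult mono_dvd_add)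

lemma keys_mon_mult:
  "Poly_Mapping.keys (mon b * p) = (\<lambda>d. b + d) ` Poly_Mapping.keys (p :: ('v, 'k::field) mpoly)"
proof (intro equalityI subsetI)
  fix e assume "e \<in> Poly_Mapping.keys (mon b * p)"
  then have "mono_dvd b e" "lk p (e - b) \<noteq> 0"
    by (auto simp: in_keys_iff lookup_single_mult split: if_splits)
  then show "e \<in> (\<lambda>d. b + d) ` Poly_Mapping.keys p"
    by (metis in_keys_iff imageI mono_dvd_diff_add)
qed (auto simp: in_keys_iff lookup_mon_mult_add)

lemma mpoly_expansion:
  "(\<Sum>b\<in>Poly_Mapping.keys p. Poly_Mapping.single b (lk p b)) = (p :: ('v, 'k::field) mpoly)"
  by (rule poly_mapping_eqI)
    (simp add: lookup_sum lookup_single when_def in_keys_iff)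

lemma single_in_ideal: "is_ideal L \<Longrightarrow> mon b \<in> L \<Longrightarrow> Poly_Mapping.single b c \<in> L"
  using ideal_mult[of L "mon b" "Poly_Mapping.single 0 c"] by (simp add: mult_single)

lemma mono_ideal_subset:
  assumes "is_ideal (L :: ('v, 'k::field) mpoly set)" "\<And>b. b \<in> B \<Longrightarrow> mon b \<in> L"
  shows "mono_ideal B \<subseteq> L"
proof
  fix p :: "('v, 'k) mpoly" assume p: "p \<in> mono_ideal B"
  have "(\<Sum>b\<in>Poly_Mapping.keys p. Poly_Mapping.single b (lk p b)) \<in> L"
    by (intro ideal_sum[OF assms(1)], rule single_in_ideal[OF assms(1)], rule assms(2))
      (use p in \<open>auto simp: mono_ideal_def\<close>)
  then show "p \<in> L" by (simp add: mpoly_expansion)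
qed

lemma mono_ideal_is_ideal:
  assumes "upclosed B"
  shows "is_ideal (mono_ideal B)"
proof (rule is_idealI)
  fix a b :: "('a, 'b) mpoly" assume "a \<in> mono_ideal B" "b \<in> mono_ideal B"
  then show "a + b \<in> mono_ideal B"
    using keys_add[of a b] by (auto simp: mono_ideal_def)
next
  fix r a :: "('a, 'b) mpoly" assume "a \<in> mono_ideal B"
  then show "r * a \<in> mono_ideal B"
    using keys_mult[of a r] assms by (fastforce simp: mono_ideal_def upclosed_def mult.commute)
qed (simp add: mono_ideal_def)

lemma mon_in_mono_ideal [simp]: "mon b \<in> mono_ideal B \<longleftrightarrow> b \<in> B"
  by (simp add: mono_ideal_def)

lemma mono_ideal_mono: "B \<subseteq> C \<Longrightarrow> mono_ideal B \<subseteq> mono_ideal C"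
  by (auto simp: mono_ideal_def)

lemma mono_ideal_UNIV: "mono_ideal UNIV = UNIV"
  by (simp add: mono_ideal_def)

lemma ideal_colon_mono_ideal: "ideal_colon (mono_ideal B) (mon u) = mono_ideal {b. u + b \<in> B}"
  unfolding ideal_colon_def mono_ideal_def
  by (auto simp: mult.commute[of _ "mon u"] keys_mon_mult)

lemma ideal_extend_mono_ideal:
  assumes "upclosed B"
  shows "ideal_extend (mono_ideal B) (mon u) =
    (mono_ideal (B \<union> {b. mono_dvd u b}) :: ('v, 'k::field) mpoly set)"
proof (rule antisym)
  have up: "upclosed (B \<union> {b. mono_dvd u b})"
    using assms unfolding upclosed_def mono_dvd_iff by (auto simp: add.assoc)
  show "ideal_extend (mono_ideal B) (mon u) \<subseteq> mono_ideal (B \<union> {b. mono_dvd u b})"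
    by (intro ideal_extend_least mono_ideal_is_ideal up mono_ideal_mono)
      (auto simp: mono_dvd_def)
  show "mono_ideal (B \<union> {b. mono_dvd u b}) \<subseteq> (ideal_extend (mono_ideal B) (mon u) :: ('v, 'k) mpoly set)"
  proof (rule mono_ideal_subset)
    show "is_ideal (ideal_extend (mono_ideal B) (mon u) :: ('v, 'k) mpoly set)"
      by (intro ideal_extend_is_ideal mono_ideal_is_ideal assms)
    fix b assume "b \<in> B \<union> {b. mono_dvd u b}"
    then show "mon b \<in> (ideal_extend (mono_ideal B) (mon u) :: ('v, 'k) mpoly set)"
    proof
      assume "b \<in> B"
      then show ?thesis using ideal_extend_superset by (metis mon_in_mono_ideal subsetD)
    next
      assume "b \<in> {b. mono_dvd u b}"
      then obtain d where "b = u + d" by (auto simp: mono_dvd_iff)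
      then have "mon b = mon d * (mon u :: ('v, 'k) mpoly)" by (simp add: mult_single add.commute)
      then show ?thesis
        using ideal_extend_generator[OF mono_ideal_is_ideal[OF assms]] by simp
    qed
  qed
qed

section \<open>Total degree and graded ideals\<close>

definition edeg :: "('v::finite \<Rightarrow>\<^sub>0 nat) \<Rightarrow> nat" where
  "edeg b = (\<Sum>v\<in>UNIV. lk b v)"

definition trunc :: "nat \<Rightarrow> ('v::finite, 'k::field) mpoly \<Rightarrow> ('v, 'k) mpoly" where
  "trunc D p = (\<Sum>b\<in>{b \<in> Poly_Mapping.keys p. edeg b \<le> D}. Poly_Mapping.single b (lk p b))"

definition homogeneous :: "nat \<Rightarrow> ('v::finite, 'k::field) mpoly \<Rightarrow> bool" where
  "homogeneous d p \<longleftrightarrow> (\<forall>b\<in>Poly_Mapping.keys p. edeg b = d)"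

text \<open>For an ideal this agrees with closure under homogeneous components, which are
  differences of successive truncations.\<close>

definition graded :: "('v::finite, 'k::field) mpoly set \<Rightarrow> bool" where
  "graded L \<longleftrightarrow> (\<forall>p\<in>L. \<forall>D. trunc D p \<in> L)"

lemma edeg_add: "edeg (b + c) = edeg b + edeg c"
  by (simp add: edeg_def lookup_add sum.distrib)

lemma lookup_trunc: "lk (trunc D p) b = (if edeg b \<le> D then lk p b else 0)"
  by (simp add: trunc_def lookup_sum lookup_single when_def in_keys_iff)

lemma keys_trunc: "Poly_Mapping.keys (trunc D p) = {b \<in> Poly_Mapping.keys p. edeg b \<le> D}"
  by (auto simp: in_keys_iff lookup_trunc split: if_splits)

lemma trunc_add: "trunc D (p + q) = trunc D p + trunc D q"
  by (rule poly_mapping_eqI) (simp add: lookup_trunc lookup_add)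

lemma trunc_eq: "(\<And>b. b \<in> Poly_Mapping.keys p \<Longrightarrow> edeg b \<le> D) \<Longrightarrow> trunc D p = p"
  by (rule poly_mapping_eqI) (metis lookup_trunc in_keys_iff)

lemma trunc_eq_0: "(\<And>b. b \<in> Poly_Mapping.keys p \<Longrightarrow> D < edeg b) \<Longrightarrow> trunc D p = 0"
  by (rule poly_mapping_eqI) (metis lookup_trunc in_keys_iff lookup_zero not_le)

lemma trunc_mult_homogeneous:
  assumes p: "homogeneous d p"
  shows "trunc D (h * p) = (if d \<le> D then trunc (D - d) h * p else 0)"
proof (cases "d \<le> D")
  case True
  let ?h = "trunc (D - d) h"
  have "trunc D (h * p) = trunc D (?h * p) + trunc D ((h - ?h) * p)"
    by (simp add: trunc_add[symmetric] algebra_simps)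
  also have "trunc D (?h * p) = ?h * p"
  proof (rule trunc_eq)
    fix b assume "b \<in> Poly_Mapping.keys (?h * p)"
    then obtain c e where "b = c + e" "c \<in> Poly_Mapping.keys ?h" "e \<in> Poly_Mapping.keys p"
      using keys_mult by blast
    then show "edeg b \<le> D" using p True by (auto simp: keys_trunc edeg_add homogeneous_def)
  qed
  also have "trunc D ((h - ?h) * p) = 0"
  proof (rule trunc_eq_0)
    fix b assume "b \<in> Poly_Mapping.keys ((h - ?h) * p)"
    then obtain c e where "b = c + e" "c \<in> Poly_Mapping.keys (h - ?h)" "e \<in> Poly_Mapping.keys p"
      using keys_mult by blast
    moreover from this have "edeg c > D - d"
      by (auto simp: in_keys_iff lookup_minus lookup_trunc split: if_splits)
    ultimately show "D < edeg b" using p True by (auto simp: edeg_add homogeneous_def)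
  qed
  finally show ?thesis using True by simp
next
  case False
  have "trunc D (h * p) = 0"
  proof (rule trunc_eq_0)
    fix b assume "b \<in> Poly_Mapping.keys (h * p)"
    then obtain c e where "b = c + e" "c \<in> Poly_Mapping.keys h" "e \<in> Poly_Mapping.keys p"
      using keys_mult by blast
    then show "D < edeg b" using p False by (auto simp: edeg_add homogeneous_def)
  qed
  then show ?thesis using False by simp
qed

lemma graded_mono_ideal: "graded (mono_ideal B)"
  by (auto simp: graded_def mono_ideal_def keys_trunc)

lemma graded_extend:
  assumes "is_ideal L" "graded L" "homogeneous d p"
  shows "graded (ideal_extend L p)"
  unfolding graded_def
proof (intro ballI allI)
  fix q D assume "q \<in> ideal_extend L p"
  then obtain a r where q: "a \<in> L" "q = a + r * p" by (auto simp: ideal_extend_def)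
  have "trunc D q = trunc D a + (if d \<le> D then trunc (D - d) r else 0) * p"
    using trunc_mult_homogeneous[OF assms(3), of D r] by (simp add: q trunc_add)
  moreover have "trunc D a \<in> L" using assms(2) q by (auto simp: graded_def)
  ultimately show "trunc D q \<in> ideal_extend L p" unfolding ideal_extend_def by blast
qed

lemma graded_foldl_extend:
  assumes "is_ideal L" "graded L" "\<And>p. p \<in> set ps \<Longrightarrow> \<exists>d. homogeneous d p"
  shows "graded (foldl ideal_extend L ps)"
  using assms
proof (induction ps arbitrary: L)
  case (Cons p ps)
  then obtain d where "homogeneous d p" by auto
  then show ?case
    using Cons graded_extend[of L d p] ideal_extend_is_ideal[of L p] by simp
qed simp

text \<open>A graded substitute for Nakayama's lemma: if \<open>f g \<in> L\<close> then
  \<open>g \<in> \<Inter>\<^sub>N (L + (y\<^sup>N)) = L\<close>.\<close>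

lemma graded_nzdI:
  assumes L: "is_ideal L" "graded L" and y: "nzd L (mon u)" and u: "edeg u > 0"
    and f: "nzd (ideal_extend L (mon u)) f"
  shows "nzd L f"
  unfolding nzd_def
proof (intro allI impI)
  fix g assume fg: "f * g \<in> L"
  have *: "\<exists>h. g - mon u ^ N * h \<in> L" for N
  proof (induction N)
    case 0
    show ?case using ideal_zero[OF L(1)] by (intro exI[of _ g]) simp
  next
    case (Suc N)
    then obtain h where h: "g - mon u ^ N * h \<in> L" by blast
    have "f * g - f * (g - mon u ^ N * h) \<in> L"
      using ideal_diff[OF L(1) fg ideal_mult[OF L(1) h]] .
    then have "mon u ^ N * (f * h) \<in> L" by (simp add: algebra_simps)
    then have "f * h \<in> L" by (rule nzdD[OF nzd_power[OF y]])
    then have "h \<in> ideal_extend L (mon u)"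
      using nzdD[OF f] ideal_extend_superset by blast
    then obtain h' where h': "h - h' * mon u \<in> L" using L by (auto simp: ideal_extend_iff)
    have "(g - mon u ^ N * h) + mon u ^ N * (h - h' * mon u) \<in> L"
      using ideal_add[OF L(1) h ideal_mult[OF L(1) h']] .
    then have "g - mon u ^ Suc N * h' \<in> L" by (simp add: algebra_simps)
    then show ?case ..
  qed
  \<comment> \<open>\<open>D\<close> is the degree of \<open>g\<close> (0 for g = 0). A multiple of
    \<open>mon u ^ Suc D\<close> has no terms up to that degree, so truncating an element of
    \<open>L\<close> that differs from \<open>g\<close> by such a multiple returns
    \<open>g\<close>.\<close>
  define D where "D = Max (insert 0 (edeg ` Poly_Mapping.keys g))"
  have D: "edeg b \<le> D" if "b \<in> Poly_Mapping.keys g" for b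
    unfolding D_def using that by (intro Max_ge) auto
  obtain h where h: "g - mon u ^ Suc D * h \<in> L" using * by blast
  have key: "N * edeg u \<le> edeg b" if "b \<in> Poly_Mapping.keys (mon u ^ N * h)" for b N
    using that
  proof (induction N arbitrary: b)
    case (Suc N)
    then obtain c where "b = u + c" "c \<in> Poly_Mapping.keys (mon u ^ N * h)"
      by (auto simp: keys_mon_mult mult.assoc)
    then show ?case using Suc.IH by (force simp: edeg_add)
  qed simp
  have "trunc D (mon u ^ Suc D * h) = 0"
  proof (rule trunc_eq_0)
    fix b assume "b \<in> Poly_Mapping.keys (mon u ^ Suc D * h)"
    then have "Suc D * edeg u \<le> edeg b" using key by blast
    moreover have "Suc D * 1 \<le> Suc D * edeg u" using u by (intro mult_le_mono2) simp
    ultimately show "D < edeg b" by simp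
  qed
  then have "trunc D (g - mon u ^ Suc D * h) = trunc D g"
    using trunc_add[of D "g - mon u ^ Suc D * h" "mon u ^ Suc D * h"] by simp
  also have "\<dots> = g" using D by (rule trunc_eq)
  finally show "g \<in> L" using L(2) h unfolding graded_def by metis
qed

section \<open>Elementary symmetric polynomials form a universal regular sequence\<close>

definition chi :: "'v::finite set \<Rightarrow> ('v \<Rightarrow>\<^sub>0 nat)" where
  "chi A = expo (\<lambda>v. of_bool (v \<in> A))"

definition esym :: "nat \<Rightarrow> ('v::finite, 'k::field) mpoly" where
  "esym i = (\<Sum>A | card A = i. mon (chi A))"

definition var_exponents :: "'v set \<Rightarrow> ('v \<Rightarrow>\<^sub>0 nat) set" where
  "var_exponents A = {b. \<exists>v\<in>A. lk b v > 0}"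

definition var_ideal :: "'v set \<Rightarrow> ('v, 'k::field) mpoly set" where
  "var_ideal A = mono_ideal (var_exponents A)"

lemma lk_chi [simp]: "lk (chi A) v = of_bool (v \<in> A)"
  by (simp add: chi_def)

lemma mpoly_var_eq: "mpoly_var v = mon (chi {v})"
  unfolding mpoly_var_def
  by (rule arg_cong[of _ _ "\<lambda>b. mon b"], rule poly_mapping_eqI) (simp add: lookup_single when_def)

lemma edeg_chi: "edeg (chi A) = card A"
  by (simp add: edeg_def of_bool_def sum.If_cases)

lemma homogeneous_esym: "homogeneous i (esym i)"
proof -
  have "Poly_Mapping.keys (esym i :: ('a, 'b) mpoly) \<subseteq>
      (\<Union>A\<in>{A. card A = i}. Poly_Mapping.keys (mon (chi A) :: ('a, 'b) mpoly))"
    unfolding esym_def by (rule Poly_Mapping.keys_sum)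
  then show ?thesis by (auto simp: homogeneous_def edeg_chi)
qed

lemma upclosed_var_exponents: "upclosed (var_exponents A)"
  by (auto simp: upclosed_def var_exponents_def lookup_add)

lemma var_ideal_is_ideal: "is_ideal (var_ideal A)"
  unfolding var_ideal_def by (intro mono_ideal_is_ideal upclosed_var_exponents)

lemma extend_var_ideal:
  "ideal_extend (var_ideal A) (mon (chi {y})) = var_ideal (insert y A)"
  unfolding var_ideal_def ideal_extend_mono_ideal[OF upclosed_var_exponents]
  by (rule arg_cong[of _ _ mono_ideal])
    (auto simp: var_exponents_def mono_dvd_def of_bool_def Suc_le_eq split: if_splits)

lemma nzd_var_ideal: "y \<notin> A \<Longrightarrow> nzd (var_ideal A) (mon (chi {y}))"
  unfolding nzd_def var_ideal_def mono_ideal_def mem_Collect_eq keys_mon_mult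
proof (intro allI impI subsetI)
  fix g d assume "y \<notin> A" "(+) (chi {y}) ` Poly_Mapping.keys g \<subseteq> var_exponents A"
    "d \<in> Poly_Mapping.keys g"
  then have "chi {y} + d \<in> var_exponents A" by blast
  then show "d \<in> var_exponents A"
    using \<open>y \<notin> A\<close> by (auto simp: var_exponents_def lookup_add of_bool_def split: if_splits)
qed

text \<open>Repeated \<open>nzd_extend_swap\<close>: a nonzerodivisor at the front of a regular
  sequence can be moved to its end.\<close>

lemma nzd_foldl_extend:
  assumes "is_ideal L" "nzd L y" "weakly_regular (ideal_extend L y) fs"
  shows "nzd (foldl ideal_extend L fs) y"
  using assms
proof (induction fs arbitrary: L)
  case (Cons f fs)
  then show ?case
    using nzd_extend_swap[of L y f] ideal_extend_is_ideal[of L f] ideal_extend_commute[of L f y]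
    by simp
qed simp

text \<open>A term of \<open>esym i\<close> survives only if its support avoids \<open>A\<close>,
  and the complement of \<open>A\<close> has a single subset with i elements.\<close>

lemma esym_mod_var_ideal:
  assumes "card (- A) = i"
  shows "esym i - mon (chi (- A)) \<in> (var_ideal A :: ('v::finite, 'k::field) mpoly set)"
proof -
  have "esym i = mon (chi (- A)) + (\<Sum>B\<in>{B. card B = i} - {- A}. mon (chi B) :: ('v, 'k) mpoly)"
    unfolding esym_def using assms by (intro sum.remove) auto
  moreover have "(\<Sum>B\<in>{B. card B = i} - {- A}. mon (chi B)) \<in> (var_ideal A :: ('v, 'k) mpoly set)"
  proof (rule ideal_sum[OF var_ideal_is_ideal])
    fix B assume B: "B \<in> {B. card B = i} - {- A}"
    have "\<not> B \<subseteq> - A"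
      using B assms card_subset_eq[of "- A" B] by auto
    then show "mon (chi B) \<in> var_ideal A"
      by (auto simp: var_ideal_def var_exponents_def)
  qed
  ultimately show ?thesis by simp
qed

lemma nzd_mon_chi:
  assumes "\<And>y. y \<in> B \<Longrightarrow> nzd L (mon (chi {y}))"
  shows "nzd L (mon (chi (B :: 'v::finite set)) :: ('v, 'k::field) mpoly)"
proof -
  have "finite B" by simp
  then show ?thesis using assms
  proof (induction B)
    case empty
    have "chi {} = (0 :: 'v \<Rightarrow>\<^sub>0 nat)" by (rule poly_mapping_eqI) simp
    then show ?case by (simp add: nzd_one)
  next
    case (insert y B)
    have "chi (insert y B) = chi {y} + chi B"
      using insert.hyps by (intro poly_mapping_eqI) (auto simp: lookup_add)
    then have "mon (chi (insert y B)) = mon (chi {y}) * (mon (chi B) :: ('v, 'k) mpoly)"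
      by (simp add: mult_single)
    then show ?case using insert by (simp add: nzd_mult)
  qed
qed

text \<open>Outer induction on \<open>t\<close> for all \<open>A\<close> at once; inner induction on
  the number of variables outside \<open>A\<close>, to show that e_(t+1) is a nonzerodivisor modulo
  \<open>Q A\<close>. Its base is the case of t + 1 remaining variables; with more, one variable is
  killed and \<open>graded_nzdI\<close> lifts the claim back.\<close>

theorem weakly_regular_esym:
  fixes A :: "'v::finite set"
  assumes "t \<le> card (- A)"
  shows "weakly_regular (var_ideal A :: ('v, 'k::field) mpoly set) (map esym [1..<Suc t])"
  using assms
proof (induction t arbitrary: A)
  case (Suc t)
  define Q where "Q A = foldl ideal_extend (var_ideal A :: ('v, 'k) mpoly set) (map esym [1..<Suc t])"
    for A
  have Q: "is_ideal (Q A)" "graded (Q A)" for A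
  proof -
    show "is_ideal (Q A)"
      unfolding Q_def by (intro foldl_extend_is_ideal var_ideal_is_ideal)
    show "graded (Q A)"
      unfolding Q_def
    proof (rule graded_foldl_extend[OF var_ideal_is_ideal])
      show "graded (var_ideal A)" unfolding var_ideal_def by (rule graded_mono_ideal)
    qed (use homogeneous_esym in auto)
  qed
  \<comment> \<open>After killing \<open>y\<close> at least t variables remain, so e_1, ..., e_t is
    still regular by the outer hypothesis and \<open>y\<close> can be moved past it.\<close>
  have y: "nzd (Q A) (mon (chi {y}))" if "y \<notin> A" "t < card (- A)" for y A
    unfolding Q_def
  proof (rule nzd_foldl_extend[OF var_ideal_is_ideal nzd_var_ideal[OF that(1)]])
    have "- A = insert y (- insert y A)" using that by auto
    then have "card (- A) = Suc (card (- insert y A))" by (metis ComplD card_insert_disjoint finite insertI1)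
    then show "weakly_regular (ideal_extend (var_ideal A :: ('v, 'k) mpoly set) (mon (chi {y}))) (map esym [1..<Suc t])"
      unfolding extend_var_ideal using that by (intro Suc.IH) simp
  qed
  have "nzd (Q A) (esym (Suc t))" if "Suc t \<le> card (- A)" for A
    using that
  proof (induction "card (- A)" arbitrary: A)
    case (Suc c)
    show ?case
    \<comment> \<open>Exactly t + 1 variables remain if c = t: then e_(t+1) is congruent to their
      product, and each of them is a nonzerodivisor.\<close>
    proof (cases "c = t")
      case True
      have "esym (Suc t) - mon (chi (- A)) \<in> Q A"
        using esym_mod_var_ideal[of A "Suc t"] Suc.hyps(2) True
          foldl_extend_superset[of "var_ideal A" "map esym [1..<Suc t]"]
        unfolding Q_def by auto
      moreover have "nzd (Q A) (mon (chi (- A)))"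
        by (rule nzd_mon_chi, rule y) (use Suc.prems in auto)
      ultimately show ?thesis using nzd_cong_mod Q by blast
    next
      case False
      have "- A \<noteq> {}" using Suc.hyps(2) by auto
      then obtain v where v: "v \<notin> A" by blast
      then have "- A = insert v (- insert v A)" by auto
      then have "card (- A) = Suc (card (- insert v A))"
        by (metis ComplD card_insert_disjoint finite insertI1)
      then have c: "c = card (- insert v A)" using Suc.hyps(2) by simp
      have "nzd (Q (insert v A)) (esym (Suc t))"
        using Suc.hyps(1)[OF c] c False Suc.prems Suc.hyps(2) by simp
      moreover have "Q (insert v A) = ideal_extend (Q A) (mon (chi {v}))"
        unfolding Q_def foldl_extend_commute[symmetric] extend_var_ideal ..
      moreover have "nzd (Q A) (mon (chi {v}))" using y v Suc.prems by simp
      ultimately show ?thesis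
        using graded_nzdI[OF Q, of A "chi {v}"] by (simp add: edeg_chi)
    qed
  qed simp
  then have "nzd (Q A) (esym (Suc t))" using Suc.prems .
  moreover have "weakly_regular (var_ideal A :: ('v, 'k) mpoly set) (map esym [1..<Suc t])"
    using Suc by simp
  ultimately show ?case
    by (simp add: weakly_regular_append Q_def)
qed simp

section \<open>The lower bound\<close>

text \<open>An ordered matching as an enumeration, with r = 0 allowed to start inductions.
  Disjointness of the edges is a consequence, see \<open>ord_seq_distinct\<close>.\<close>

definition ord_seq :: "'v set set \<Rightarrow> (nat \<Rightarrow> 'v) \<Rightarrow> (nat \<Rightarrow> 'v) \<Rightarrow> nat \<Rightarrow> bool" where
  "ord_seq E a b r \<longleftrightarrow> (\<forall>i\<in>{1..r}. {a i, b i} \<in> E) \<and> independent E (a ` {1..r}) \<and>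
     (\<forall>i\<in>{1..r}. \<forall>j\<in>{1..r}. {a i, b j} \<in> E \<longrightarrow> i \<le> j)"

text \<open>With \<open>Z = {}\<close> and \<open>c = 0\<close> these are the exponents of the monomials in the \<open>k\<close>-th symbolic
  power. A positive \<open>c\<close> arises from taking a colon, a nonempty \<open>Z\<close> from adding variables.\<close>

definition cover_exponents ::
    "'v set set \<Rightarrow> nat \<Rightarrow> ('v \<Rightarrow> nat) \<Rightarrow> 'v set \<Rightarrow> ('v \<Rightarrow>\<^sub>0 nat) set" where
  "cover_exponents E k c Z = var_exponents Z \<union>
     {b. \<forall>i j. {i, j} \<in> E \<and> i \<notin> Z \<and> j \<notin> Z \<longrightarrow> k \<le> lk b i + c i + (lk b j + c j)}"

text \<open>These are the edges that still impose a condition in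
  \<open>cover_exponents\<close>.\<close>

definition deficient :: "'v set set \<Rightarrow> nat \<Rightarrow> ('v \<Rightarrow> nat) \<Rightarrow> 'v set \<Rightarrow> 'v \<Rightarrow> 'v \<Rightarrow> bool" where
  "deficient E k c Z i j \<longleftrightarrow> {i, j} \<in> E \<and> i \<notin> Z \<and> j \<notin> Z \<and> c i + c j < k"

lemma simple_graph_no_loop: "simple_graph E \<Longrightarrow> {i, j} \<in> E \<Longrightarrow> i \<noteq> j"
  by (auto simp: simple_graph_def)

lemma deficient_sym: "deficient E k c Z i j \<Longrightarrow> deficient E k c Z j i"
  by (auto simp: deficient_def insert_commute add.commute)

lemma upclosed_Un: "upclosed A \<Longrightarrow> upclosed B \<Longrightarrow> upclosed (A \<union> B)"
  by (auto simp: upclosed_def)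

lemma upclosed_mono_dvd: "upclosed {b. mono_dvd w b}"
  by (auto simp: upclosed_def mono_dvd_def lookup_add trans_le_add1)

lemma upclosed_cover_exponents: "upclosed (cover_exponents E k c Z)"
  unfolding cover_exponents_def
proof (rule upclosed_Un[OF upclosed_var_exponents])
  show "upclosed {b. \<forall>i j. {i, j} \<in> E \<and> i \<notin> Z \<and> j \<notin> Z \<longrightarrow> k \<le> lk b i + c i + (lk b j + c j)}"
    unfolding upclosed_def
  proof (intro ballI allI CollectI impI)
    fix b d i j
    assume "b \<in> {b. \<forall>i j. {i, j} \<in> E \<and> i \<notin> Z \<and> j \<notin> Z \<longrightarrow> k \<le> lk b i + c i + (lk b j + c j)}"
      "{i, j} \<in> E \<and> i \<notin> Z \<and> j \<notin> Z"
    then have "k \<le> lk b i + c i + (lk b j + c j)" by blast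
    then show "k \<le> lk (b + d) i + c i + (lk (b + d) j + c j)" by (simp add: lookup_add)
  qed
qed

lemma mono_dvd_chi: "mono_dvd (chi {v}) b \<longleftrightarrow> 0 < lk b v"
  by (auto simp: mono_dvd_def of_bool_def Suc_le_eq)

text \<open>Induction on the degree of \<open>w\<close>. For a variable v of \<open>w\<close>
  outside \<open>A\<close>, the colon by v cancels it from \<open>w\<close>, while adjoining v
  swallows \<open>w\<close>; the \<open>Suc\<close> in the assumption pays for this one extra
  variable. If v lies in \<open>A\<close>, then \<open>w\<close> is redundant.\<close>

lemma weakly_regular_var_principal:
  fixes A :: "'v::finite set"
  assumes "Suc (card A + t) \<le> card (UNIV :: 'v set)"
  shows "weakly_regular (mono_ideal (var_exponents A \<union> {b. mono_dvd w b}) :: ('v, 'k::field) mpoly set)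
    (map esym [1..<Suc t])"
proof (induction "edeg w" arbitrary: w)
  case 0
  then have "var_exponents A \<union> {b. mono_dvd w b} = UNIV"
    by (auto simp: edeg_def mono_dvd_def)
  then show ?case by (simp only: mono_ideal_UNIV weakly_regular_UNIV)
next
  case (Suc d)
  have "\<exists>v. lk w v > 0"
  proof (rule ccontr)
    assume "\<nexists>v. lk w v > 0"
    then show False using Suc.hyps(2) by (simp add: edeg_def)
  qed
  then obtain v where v: "lk w v > 0" ..
  have pos: "0 < lk b v" if "mono_dvd w b" for b
    using that v unfolding mono_dvd_def by (metis less_le_trans)
  have card: "card (- B) = card (UNIV :: 'v set) - card B" for B :: "'v set"
    by (simp add: Compl_eq_Diff_UNIV card_Diff_subset)
  show ?case
  proof (cases "v \<in> A")
    case True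
    have "var_exponents A \<union> {b. mono_dvd w b} = var_exponents A"
      using True pos by (auto simp: var_exponents_def)
    moreover have "weakly_regular (var_ideal A :: ('v, 'k) mpoly set) (map esym [1..<Suc t])"
      using assms card by (intro weakly_regular_esym) simp
    ultimately show ?thesis by (simp only: var_ideal_def)
  next
    case False
    define w' where "w' = w - chi {v}"
    have w: "w = chi {v} + w'"
      unfolding w'_def using v by (intro mono_dvd_diff_add[symmetric]) (auto simp: mono_dvd_def of_bool_def)
    have w': "edeg w' = d"
      using Suc.hyps(2) by (simp add: w edeg_add edeg_chi)
    have up: "upclosed (var_exponents A \<union> {b. mono_dvd w b})"
      by (intro upclosed_Un upclosed_var_exponents upclosed_mono_dvd)
    show ?thesis
    proof (rule weakly_regular_colonI[of _ "mon (chi {v})"])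
      show "is_ideal (mono_ideal (var_exponents A \<union> {b. mono_dvd w b}))"
        by (rule mono_ideal_is_ideal[OF up])
      have "{b. chi {v} + b \<in> var_exponents A \<union> {b. mono_dvd w b}}
          = var_exponents A \<union> {b. mono_dvd w' b}"
      proof -
        have "chi {v} + b \<in> var_exponents A \<longleftrightarrow> b \<in> var_exponents A" for b
          using False by (auto simp: var_exponents_def lookup_add of_bool_def split: if_splits)
        moreover have "mono_dvd w (chi {v} + b) \<longleftrightarrow> mono_dvd w' b" for b
          unfolding w by (simp add: mono_dvd_def lookup_add)
        ultimately show ?thesis by auto
      qed
      then show "weakly_regular
          (ideal_colon (mono_ideal (var_exponents A \<union> {b. mono_dvd w b}) :: ('v, 'k) mpoly set)
            (mon (chi {v}))) (map esym [1..<Suc t])"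
        unfolding ideal_colon_mono_ideal using Suc.hyps(1)[OF w'[symmetric]] by (simp only:)
      have "var_exponents A \<union> {b. mono_dvd w b} \<union> {b. mono_dvd (chi {v}) b} = var_exponents (insert v A)"
        using pos by (auto simp: var_exponents_def mono_dvd_chi)
      moreover have "weakly_regular (var_ideal (insert v A) :: ('v, 'k) mpoly set) (map esym [1..<Suc t])"
        using False assms card by (intro weakly_regular_esym) simp
      ultimately show "weakly_regular
          (ideal_extend (mono_ideal (var_exponents A \<union> {b. mono_dvd w b}) :: ('v, 'k) mpoly set)
            (mon (chi {v}))) (map esym [1..<Suc t])"
        unfolding ideal_extend_mono_ideal[OF up]
        by (simp only: var_ideal_def)
    qed
  qed
qed

text \<open>With the new edge in last position, edges from earlier \<open>a i\<close> to
  \<open>y\<close> respect the order automatically; only edges from \<open>x\<close> to earlier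
  vertices have to be excluded.\<close>

lemma ord_seq_snoc:
  assumes ab: "ord_seq E a b r" and xy: "{x, y} \<in> E"
    and x: "\<And>i. i \<in> {1..r} \<Longrightarrow> {x, a i} \<notin> E" "\<And>i. i \<in> {1..r} \<Longrightarrow> {x, b i} \<notin> E" "{x, x} \<notin> E"
  shows "ord_seq E (a(Suc r := x)) (b(Suc r := y)) (Suc r)"
proof -
  have e1: "\<And>i. i \<in> {1..r} \<Longrightarrow> {a i, b i} \<in> E"
    and ind: "\<And>u v. u \<in> a ` {1..r} \<Longrightarrow> v \<in> a ` {1..r} \<Longrightarrow> {u, v} \<notin> E"
    and ord: "\<And>i j. i \<in> {1..r} \<Longrightarrow> j \<in> {1..r} \<Longrightarrow> {a i, b j} \<in> E \<Longrightarrow> i \<le> j"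
    using ab unfolding ord_seq_def independent_def by blast+
  show ?thesis
    unfolding ord_seq_def
  proof (intro conjI ballI impI)
    fix i assume "i \<in> {1..Suc r}"
    then show "{(a(Suc r := x)) i, (b(Suc r := y)) i} \<in> E"
      using e1[of i] xy by (cases "i = Suc r") simp_all
  next
    have im: "a(Suc r := x) ` {1..Suc r} = insert x (a ` {1..r})"
      unfolding atLeastAtMostSuc_conv[of 1 r, simplified] by auto
    have "{x, u} \<notin> E \<and> {u, x} \<notin> E" if "u \<in> a ` {1..r}" for u
      using that x(1) by (auto simp: insert_commute)
    then show "independent E (a(Suc r := x) ` {1..Suc r})"
      unfolding im independent_def using ind x(3) by (simp only: ball_simps) blast
  next
    fix i j assume ij: "i \<in> {1..Suc r}" "j \<in> {1..Suc r}"
      and e: "{(a(Suc r := x)) i, (b(Suc r := y)) j} \<in> E"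
    show "i \<le> j"
    proof (cases "j = Suc r")
      case False
      then have j: "j \<in> {1..r}" using ij by auto
      then have "i \<noteq> Suc r" using e x(2)[OF j] by auto
      then have "i \<in> {1..r}" "{a i, b j} \<in> E" using ij e j by auto
      then show ?thesis using ord j by blast
    qed (use ij in simp)
  qed
qed

text \<open>Let \<open>x\<close> be a vertex of minimal \<open>c\<close>-value on a deficient edge. Taking the colon by \<open>x\<close> raises \<open>c x\<close>. After
  adding \<open>x\<close> instead, the colon by the monomial \<open>w\<close> repairs all deficient edges at \<open>x\<close>; by minimality of
  \<open>c x\<close> the deficient edges that remain avoid all neighbours of \<open>x\<close> in the graph, so an ordered matching
  among them can be extended by a last edge at \<open>x\<close>.\<close>

lemma weakly_regular_cover:
  fixes E :: "'v::finite set set"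
  assumes E: "simple_graph E"
    and q: "\<And>a b r. ord_seq E a b r \<Longrightarrow>
      (\<And>i. i \<in> {1..r} \<Longrightarrow> Ex (deficient E k c Z (a i)) \<and> Ex (deficient E k c Z (b i))) \<Longrightarrow> r \<le> q"
    and "Suc (card Z + q + t) \<le> card (UNIV :: 'v set)"
  shows "weakly_regular (mono_ideal (cover_exponents E k c Z) :: ('v, 'k::field) mpoly set)
    (map esym [1..<Suc t])"
  using q assms(3)
\<comment> \<open>The weight missing outside \<open>Z\<close> drops in both branches: the colon by x
  raises \<open>c x\<close>, and adjoining x removes its positive summand
  \<open>k - c x\<close>.\<close>
proof (induction "\<Sum>v\<in>- Z. k - c v" arbitrary: c Z q rule: less_induct)
  case less
  let ?fs = "map esym [1..<Suc t] :: ('v, 'k) mpoly list"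
  let ?D = "deficient E k c Z"
  let ?U = "{i. Ex (?D i)}"
  show ?case
  proof (cases "?U = {}")
    case True
    then have "c i + c j \<ge> k" if "{i, j} \<in> E" "i \<notin> Z" "j \<notin> Z" for i j
      using that by (auto simp: deficient_def not_less)
    then have "cover_exponents E k c Z = UNIV"
      by (force simp: cover_exponents_def)
    then show ?thesis by (simp only: mono_ideal_UNIV weakly_regular_UNIV)
  next
    case False
    define x where "x = arg_min_on c ?U"
    have x: "x \<in> ?U" and min: "\<And>z. z \<in> ?U \<Longrightarrow> c x \<le> c z"
      unfolding x_def using arg_min_if_finite(1)[OF _ False, of c] arg_min_least[OF _ False, of _ c]
      by simp_all
    obtain y where y: "?D x y" using x by blast
    have xZ: "x \<notin> Z" and xy: "x \<noteq> y" "{x, y} \<in> E" "c x + c y < k"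
      using y simple_graph_no_loop[OF E, of x y] by (auto simp: deficient_def)
    have cx: "c x < k - c x"
    proof -
      have "c x \<le> c y" by (rule min) (use deficient_sym[OF y] in blast)
      then show ?thesis using xy by linarith
    qed
    \<comment> \<open>The single edge x y already forces q >= 1, so \<open>q - 1\<close> below is a
      true subtraction.\<close>
    have "ord_seq E (\<lambda>_. x) (\<lambda>_. y) 1"
      using simple_graph_no_loop[OF E, of x x] xy by (auto simp: ord_seq_def independent_def)
    then have q1: "1 \<le> q" by (rule less.prems(1)) (use y deficient_sym[OF y] in blast)

    let ?c1 = "c(x := Suc (c x))"
    have R1: "weakly_regular (mono_ideal (cover_exponents E k ?c1 Z) :: ('v, 'k) mpoly set) ?fs"
    proof (rule less.hyps)
      show "(\<Sum>v\<in>- Z. k - ?c1 v) < (\<Sum>v\<in>- Z. k - c v)"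
        using xZ xy by (intro sum_strict_mono_ex1) auto
      have "?D i j" if "deficient E k ?c1 Z i j" for i j
        using that by (auto simp: deficient_def split: if_splits)
      then show "r \<le> q" if "ord_seq E a b r" "\<And>i. i \<in> {1..r} \<Longrightarrow>
          Ex (deficient E k ?c1 Z (a i)) \<and> Ex (deficient E k ?c1 Z (b i))" for a b r
        by (intro less.prems(1)[OF that(1)]) (use that(2) in blast)
    qed (use less.prems in auto)

    \<comment> \<open>\<open>w\<close> is what the deficient edges at x lack once the exponent of x
      is 0. After the colon by \<open>w\<close> the weights are \<open>c2\<close>, and every edge
      from x to a vertex outside \<open>Z\<close> has weight at least k.\<close>
    define w where "w = expo (\<lambda>y. if ?D x y then k - c x - c y else 0)"
    define c2 where "c2 = (\<lambda>y. if ?D x y then k - c x else c y)"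
    have c2_ge: "c v \<le> c2 v" for v by (auto simp: c2_def deficient_def)
    \<comment> \<open>Suppose x i were an edge. If it is deficient, then
      \<open>c2 i = k - c x\<close> and \<open>c2 j \<ge> c x\<close>. If not, then
      \<open>c x + c i \<ge> k\<close> and \<open>c j \<ge> c x\<close>. Either way i j would not be
      deficient.\<close>
    have sub: "?D i j \<and> {x, i} \<notin> E \<and> i \<noteq> x" if ij: "deficient E k c2 (insert x Z) i j" for i j
    proof -
      have ij': "{i, j} \<in> E" "i \<notin> Z" "j \<notin> Z" "i \<noteq> x" "j \<noteq> x" "c2 i + c2 j < k"
        using ij by (auto simp: deficient_def)
      have D: "?D i j"
        using ij' c2_ge[of i] c2_ge[of j] by (auto simp: deficient_def)
      then have "c x \<le> c i" "c x \<le> c j" using min deficient_sym[OF D] by blast+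
      then have le: "c x \<le> c2 j" using c2_ge[of j] by simp
      have "{x, i} \<notin> E"
      proof
        assume xi: "{x, i} \<in> E"
        show False
        proof (cases "?D x i")
          case True
          then show False using ij'(6) le cx by (auto simp: c2_def)
        next
          case False
          then have "k \<le> c x + c i" using xi xZ ij' by (auto simp: deficient_def)
          then show False using D \<open>c x \<le> c j\<close> by (auto simp: deficient_def)
        qed
      qed
      then show ?thesis using D ij' by simp
    qed
    have R2: "weakly_regular (mono_ideal (cover_exponents E k c2 (insert x Z)) :: ('v, 'k) mpoly set) ?fs"
    proof (rule less.hyps[of c2 "insert x Z" "q - 1"])
      have "- Z = insert x (- insert x Z)" using xZ by auto
      then have "(\<Sum>v\<in>- Z. k - c v) = (k - c x) + (\<Sum>v\<in>- insert x Z. k - c v)"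
        by (metis ComplD finite insertI1 sum.insert)
      moreover have "(\<Sum>v\<in>- insert x Z. k - c2 v) \<le> (\<Sum>v\<in>- insert x Z. k - c v)"
        using c2_ge by (intro sum_mono) (simp add: diff_le_mono2)
      ultimately show "(\<Sum>v\<in>- insert x Z. k - c2 v) < (\<Sum>v\<in>- Z. k - c v)"
        using cx by simp
      show "Suc (card (insert x Z) + (q - 1) + t) \<le> card (UNIV :: 'v set)"
        using less.prems(2) xZ q1 by simp
      fix a b r
      assume ab: "ord_seq E a b r" and def: "\<And>i. i \<in> {1..r} \<Longrightarrow>
        Ex (deficient E k c2 (insert x Z) (a i)) \<and> Ex (deficient E k c2 (insert x Z) (b i))"
      have "ord_seq E (a(Suc r := x)) (b(Suc r := y)) (Suc r)"
      proof (rule ord_seq_snoc[OF ab xy(2)])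
        show "{x, a i} \<notin> E" "{x, b i} \<notin> E" if "i \<in> {1..r}" for i
          using def[OF that] sub by blast+
        show "{x, x} \<notin> E" using simple_graph_no_loop[OF E] by blast
      qed
      moreover have "Ex (?D ((a(Suc r := x)) i)) \<and> Ex (?D ((b(Suc r := y)) i))"
        if "i \<in> {1..Suc r}" for i
      proof (cases "i = Suc r")
        case True
        then show ?thesis using y deficient_sym[OF y] by auto
      next
        case False
        then have "i \<in> {1..r}" using that by auto
        then show ?thesis using def[of i] sub False by (metis fun_upd_other)
      qed
      ultimately have "Suc r \<le> q" by (rule less.prems(1))
      then show "r \<le> q - 1" by simp
    qed

    \<comment> \<open>\<open>B\<close> belongs to the ideal with x adjoined. It still carries the
      conditions of the edges at x; the colon by \<open>w\<close> fulfils them and leads to the case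
      \<open>R2\<close>.\<close>
    define B where "B = cover_exponents E k c Z \<union> {b. mono_dvd (chi {x}) b}"
    have B: "b \<in> B \<longleftrightarrow> (\<exists>z\<in>insert x Z. lk b z > 0) \<or>
      (\<forall>i j. {i, j} \<in> E \<and> i \<notin> Z \<and> j \<notin> Z \<longrightarrow> k \<le> lk b i + c i + (lk b j + c j))" for b
      by (auto simp: B_def cover_exponents_def var_exponents_def mono_dvd_chi)
    have upB: "upclosed B"
      unfolding B_def by (intro upclosed_Un upclosed_cover_exponents upclosed_mono_dvd)
    have wz: "lk w z = 0" if "z \<in> insert x Z" for z
      using that xZ simple_graph_no_loop[OF E, of x x] by (auto simp: w_def deficient_def)
    have wc: "lk w v + c v = c2 v" for v
      by (auto simp: w_def c2_def deficient_def)
    have xj: "k \<le> c x + (lk w j + c j)" if "{x, j} \<in> E" "j \<notin> Z" for j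
      using that xZ by (auto simp: wc c2_def deficient_def)
    have "{b. w + b \<in> B} = cover_exponents E k c2 (insert x Z)"
    proof (rule Set.set_eqI)
      fix b
      show "b \<in> {b. w + b \<in> B} \<longleftrightarrow> b \<in> cover_exponents E k c2 (insert x Z)"
      proof (cases "\<exists>z\<in>insert x Z. lk b z > 0")
        case True
        then show ?thesis by (auto simp: B cover_exponents_def var_exponents_def lookup_add)
      next
        case False
        then have *: "w + b \<in> B \<longleftrightarrow> (\<forall>i j. {i, j} \<in> E \<and> i \<notin> Z \<and> j \<notin> Z \<longrightarrow>
            k \<le> lk b i + c2 i + (lk b j + c2 j))"
          using wz by (auto simp: B lookup_add wc[symmetric] add_ac)
        have "k \<le> lk b i + c2 i + (lk b j + c2 j)"
          if "{i, j} \<in> E" "i \<notin> Z" "j \<notin> Z" "i = x \<or> j = x" for i j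
          using that xj[of i] xj[of j] wz[of x]
          by (auto simp: wc[symmetric] insert_commute)
        moreover have "b \<in> cover_exponents E k c2 (insert x Z) \<longleftrightarrow>
          (\<forall>i j. {i, j} \<in> E \<and> i \<notin> insert x Z \<and> j \<notin> insert x Z \<longrightarrow>
            k \<le> lk b i + c2 i + (lk b j + c2 j))"
          using False by (simp add: cover_exponents_def var_exponents_def)
        ultimately show ?thesis unfolding mem_Collect_eq * by blast
      qed
    qed
    then have R2': "weakly_regular (ideal_colon (mono_ideal B :: ('v, 'k) mpoly set) (mon w)) ?fs"
      unfolding ideal_colon_mono_ideal using R2 by (simp only:)
    \<comment> \<open>An exponent of \<open>B\<close> without x and \<open>Z\<close> satisfies the
      conditions at x with exponent 0 there, hence is divisible by \<open>w\<close>. So adjoining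
      \<open>w\<close> leaves just variables and \<open>w\<close>.\<close>
    have "B \<union> {b. mono_dvd w b} = var_exponents (insert x Z) \<union> {b. mono_dvd w b}"
    proof -
      have "mono_dvd w b" if "b \<in> B" "b \<notin> var_exponents (insert x Z)" for b
        unfolding mono_dvd_def
      proof
        fix v
        have b: "lk b x = 0" and cond: "{i, j} \<in> E \<Longrightarrow> i \<notin> Z \<Longrightarrow> j \<notin> Z \<Longrightarrow>
            k \<le> lk b i + c i + (lk b j + c j)" for i j
          using that by (auto simp: B var_exponents_def)
        show "lk w v \<le> lk b v"
        proof (cases "?D x v")
          case True
          then have "k \<le> lk b x + c x + (lk b v + c v)" by (intro cond) (auto simp: deficient_def)
          then show ?thesis using True b by (simp add: w_def)
        qed (simp add: w_def)
      qed
      moreover have "var_exponents (insert x Z) \<subseteq> B" by (auto simp: B var_exponents_def)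
      ultimately show ?thesis by blast
    qed
    moreover have "weakly_regular
        (mono_ideal (var_exponents (insert x Z) \<union> {b. mono_dvd w b}) :: ('v, 'k) mpoly set) ?fs"
      using less.prems(2) xZ q1 by (intro weakly_regular_var_principal) simp
    ultimately have R3: "weakly_regular (ideal_extend (mono_ideal B :: ('v, 'k) mpoly set) (mon w)) ?fs"
      unfolding ideal_extend_mono_ideal[OF upB]
      by (simp only:)
    have RB: "weakly_regular (mono_ideal B :: ('v, 'k) mpoly set) ?fs"
      using weakly_regular_colonI[OF mono_ideal_is_ideal[OF upB] R2' R3] .
    have "{b. chi {x} + b \<in> cover_exponents E k c Z} = cover_exponents E k ?c1 Z"
      using xZ by (auto simp: cover_exponents_def var_exponents_def lookup_add of_bool_def)
    then have "weakly_regular (ideal_colon (mono_ideal (cover_exponents E k c Z) :: ('v, 'k) mpoly set)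
        (mon (chi {x}))) ?fs"
      unfolding ideal_colon_mono_ideal using R1 by (simp only:)
    moreover have "weakly_regular (ideal_extend (mono_ideal (cover_exponents E k c Z) :: ('v, 'k) mpoly set)
        (mon (chi {x}))) ?fs"
      unfolding ideal_extend_mono_ideal[OF upclosed_cover_exponents] using RB by (simp only: B_def)
    ultimately show ?thesis
      by (rule weakly_regular_colonI[OF mono_ideal_is_ideal[OF upclosed_cover_exponents]])
  qed
qed

section \<open>Koszul cochains and the upper bound\<close>

text \<open>Cochains are arbitrary functions on tuples of indices, not only alternating ones on sets: all
  identities become one-line inductions, without any signs, and alternation is never needed.\<close>

fun koszul :: "('v \<Rightarrow> 'a::comm_ring_1) \<Rightarrow> ('v list \<Rightarrow> 'a) \<Rightarrow> 'v list \<Rightarrow> 'a" where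
  "koszul y z [] = 0"
| "koszul y z (v # vs) = y v * z vs - koszul y (\<lambda>us. z (v # us)) vs"

definition contract :: "('v::finite \<Rightarrow> 'a::comm_ring_1) \<Rightarrow> ('v list \<Rightarrow> 'a) \<Rightarrow> 'v list \<Rightarrow> 'a" where
  "contract g z vs = (\<Sum>v\<in>UNIV. g v * z (v # vs))"

text \<open>The \<open>d\<close>-th Koszul cohomology of the ring modulo \<open>L\<close> does not vanish.\<close>

definition koszul_nontrivial :: "('v \<Rightarrow> 'a::comm_ring_1) \<Rightarrow> 'a set \<Rightarrow> nat \<Rightarrow> bool" where
  "koszul_nontrivial y L d \<longleftrightarrow>
    (\<exists>z. (\<forall>vs. length vs = Suc d \<longrightarrow> koszul y z vs \<in> L) \<and>
      \<not> (\<exists>w. \<forall>vs. length vs = d \<longrightarrow> z vs - koszul y w vs \<in> L))"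

lemma koszul_diff: "koszul y (\<lambda>us. z us - z' us) vs = koszul y z vs - koszul y z' vs"
  by (induction vs arbitrary: z z') (simp_all add: algebra_simps)

lemma koszul_add: "koszul y (\<lambda>us. z us + z' us) vs = koszul y z vs + koszul y z' vs"
  by (induction vs arbitrary: z z') (simp_all add: algebra_simps)

lemma koszul_zero: "koszul y (\<lambda>us. 0) vs = 0"
  by (induction vs) simp_all

lemma koszul_mult: "koszul y (\<lambda>us. c * z us) vs = c * koszul y z vs"
  by (induction vs arbitrary: z) (simp_all add: algebra_simps)

lemma koszul_sum: "koszul y (\<lambda>us. \<Sum>i\<in>I. f i us) vs = (\<Sum>i\<in>I. koszul y (f i) vs)"
  by (induction I rule: infinite_finite_induct) (simp_all add: koszul_add koszul_zero)

lemma koszul_weight_sum: "koszul (\<lambda>v. \<Sum>i\<in>I. y i v) z vs = (\<Sum>i\<in>I. koszul (y i) z vs)"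
  by (induction vs arbitrary: z) (simp_all add: sum_distrib_right sum_subtractf)

lemma koszul_weight_add: "koszul (\<lambda>v. y v + y' v) z vs = koszul y z vs + koszul y' z vs"
  by (induction vs arbitrary: z) (simp_all add: algebra_simps)

lemma koszul_weight_mult: "koszul (\<lambda>v. c * y v) z vs = c * koszul y z vs"
  by (induction vs arbitrary: z) (simp_all add: algebra_simps)

lemma koszul_weight_zero: "(\<And>v. v \<in> set vs \<Longrightarrow> y v = 0) \<Longrightarrow> koszul y z vs = 0"
  by (induction vs arbitrary: z) simp_all

lemma koszul_anticommute: "koszul y (koszul y' z) vs = - koszul y' (koszul y z) vs"
proof (induction vs arbitrary: z)
  case (Cons v vs)
  have "koszul y (koszul y' z) (v # vs) = y v * koszul y' z vs - y' v * koszul y z vs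
      + koszul y (koszul y' (\<lambda>us. z (v # us))) vs" for y y'
    by (simp add: koszul_diff koszul_mult)
  from this[of y y'] this[of y' y] show ?case by (simp only: Cons.IH[of "\<lambda>us. z (v # us)"]) simp
qed simp

lemma koszul_koszul: "koszul y (koszul y z) vs = 0"
proof (induction vs arbitrary: z)
  case (Cons v vs)
  then show ?case by (simp add: koszul_diff koszul_mult)
qed simp

text \<open>The homotopy formula: multiplication by an element of the ideal generated by the weights
  is null-homotopic, with contraction as the homotopy.\<close>

lemma koszul_contract:
  "koszul y (contract g z) vs + contract g (koszul y z) vs = (\<Sum>v\<in>UNIV. g v * y v) * z vs"
proof -
  have "koszul y (contract g z) vs = (\<Sum>v\<in>UNIV. g v * koszul y (\<lambda>us. z (v # us)) vs)"
    by (simp add: contract_def[abs_def] koszul_sum koszul_mult)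
  then show ?thesis
    by (simp add: contract_def sum_distrib_right right_diff_distrib sum_subtractf mult.assoc)
qed

text \<open>\<open>koszul y z vs\<close> is an alternating sum over the ways to take one entry out
  of \<open>vs\<close>. A property closed under differences can be checked on the single terms, with
  no signs to track.\<close>

lemma koszul_induct:
  assumes "Q 0" "\<And>a b. Q a \<Longrightarrow> Q b \<Longrightarrow> Q (a - b)"
    and "\<And>us v ws. vs = us @ v # ws \<Longrightarrow> Q (y v * z (us @ ws))"
  shows "Q (koszul y z vs)"
  using assms(3)
proof (induction vs arbitrary: z)
  case (Cons v vs)
  have "Q (koszul y (\<lambda>us. z (v # us)) vs)"
  proof (rule Cons.IH)
    fix us v' ws assume "vs = us @ v' # ws"
    then show "Q (y v' * z (v # us @ ws))" using Cons.prems[of "v # us" v' ws] by simp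
  qed
  then show ?case using Cons.prems[of "[]" v vs] by (simp add: assms(2))
qed (simp add: assms(1))

lemma koszul_in_ideal:
  assumes "is_ideal L" "\<And>us. Suc (length us) = length vs \<Longrightarrow> z us \<in> L"
  shows "koszul y z vs \<in> L"
proof (rule koszul_induct[where Q = "\<lambda>p. p \<in> L"])
  show "0 \<in> L" "\<And>a b. a \<in> L \<Longrightarrow> b \<in> L \<Longrightarrow> a - b \<in> L"
    using ideal_zero ideal_diff assms(1) by blast+
  show "y v * z (us @ ws) \<in> L" if "vs = us @ v # ws" for us v ws
    by (intro ideal_mult assms) (simp add: that)
qed

text \<open>Since \<open>f\<close> annihilates the cohomology modulo \<open>L\<close>, the
  connecting map of multiplication by \<open>f\<close> is onto in degree \<open>d\<close>, and
  \<open>contract g z\<close> is an explicit preimage of the class of \<open>z\<close>.\<close>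

lemma koszul_nontrivial_step:
  fixes L :: "'a::comm_ring_1 set" and y :: "'v::finite \<Rightarrow> 'a"
  assumes L: "is_ideal L" and f: "f = (\<Sum>v\<in>UNIV. g v * y v)" "nzd L f"
    and H: "koszul_nontrivial y L d"
  shows "\<exists>e. d = Suc e \<and> koszul_nontrivial y (ideal_extend L f) e"
proof -
  obtain z where z: "\<And>vs. length vs = Suc d \<Longrightarrow> koszul y z vs \<in> L"
    and nz: "\<not> (\<exists>w. \<forall>vs. length vs = d \<longrightarrow> z vs - koszul y w vs \<in> L)"
    using H unfolding koszul_nontrivial_def by blast
  have c: "contract g (koszul y z) vs \<in> L" if "length vs = d" for vs
    unfolding contract_def using that by (intro ideal_sum[OF L] ideal_mult[OF L] z) simp
  have h: "koszul y (contract g z) vs = f * z vs - contract g (koszul y z) vs" for vs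
    using koszul_contract[of y g z vs] by (simp add: f(1) algebra_simps)
  show ?thesis
  proof (cases d)
    case 0
    \<comment> \<open>Every coboundary vanishes at the empty tuple, so \<open>z []\<close> in
      \<open>L\<close> means that the class is trivial.\<close>
    have "f * z [] \<in> L" using c[of "[]"] h[of "[]"] 0 by simp
    then have "z [] \<in> L" by (rule nzdD[OF f(2)])
    then show ?thesis using nz 0 by simp
  next
    case (Suc e)
    let ?w = "contract g z"
    have "koszul_nontrivial y (ideal_extend L f) e"
      unfolding koszul_nontrivial_def
    proof (intro exI[of _ ?w] conjI allI impI notI)
      fix vs :: "'v list" assume "length vs = Suc e"
      then have "- contract g (koszul y z) vs \<in> L" using c Suc ideal_uminus[OF L] by blast
      then show "koszul y ?w vs \<in> ideal_extend L f"
        unfolding h using ideal_extend_iff[OF L]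
        by (metis add.commute add_diff_cancel_right' mult.commute diff_conv_add_uminus)
    next
      assume "\<exists>w. \<forall>vs. length vs = e \<longrightarrow> ?w vs - koszul y w vs \<in> ideal_extend L f"
      then obtain w where "\<forall>vs. length vs = e \<longrightarrow> (\<exists>r. ?w vs - koszul y w vs - r * f \<in> L)"
        using ideal_extend_iff[OF L] by blast
      then obtain r where r: "\<And>vs. length vs = e \<Longrightarrow> ?w vs - koszul y w vs - f * r vs \<in> L"
        by (metis mult.commute)
      have "z vs - koszul y r vs \<in> L" if vs: "length vs = d" for vs
      proof -
        \<comment> \<open>Applying the differential removes \<open>w\<close>; what remains says that
          f (z - koszul y r) is in \<open>L\<close>.\<close>
        have "koszul y (\<lambda>vs. ?w vs - koszul y w vs - f * r vs) vs \<in> L"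
          by (rule koszul_in_ideal[OF L r]) (use vs Suc in simp)
        then have "koszul y ?w vs - f * koszul y r vs \<in> L"
          by (simp add: koszul_diff koszul_mult koszul_koszul)
        then have "koszul y ?w vs - f * koszul y r vs + contract g (koszul y z) vs \<in> L"
          by (rule ideal_add[OF L _ c[OF vs]])
        then have "f * (z vs - koszul y r vs) \<in> L" by (simp add: h algebra_simps)
        then show ?thesis by (rule nzdD[OF f(2)])
      qed
      then show False using nz by blast
    qed
    then show ?thesis using Suc by blast
  qed
qed

text \<open>Only powers of the \<open>f\<close> need to lie in the ideal \<open>(y)\<close>. This allows for high powers of the
  variables among the \<open>y\<close>, as in the Cech complex.\<close>

lemma length_weakly_regular_le:
  fixes L :: "'a::comm_ring_1 set" and y :: "'v::finite \<Rightarrow> 'a"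
  assumes "is_ideal L" "weakly_regular L fs" "koszul_nontrivial y L d"
    and "\<And>f. f \<in> set fs \<Longrightarrow> \<exists>k g. f ^ k = (\<Sum>v\<in>UNIV. g v * y v)"
  shows "length fs \<le> d"
  using assms
proof (induction fs arbitrary: L d)
  case (Cons f fs)
  then obtain k g where g: "f ^ k = (\<Sum>v\<in>UNIV. g v * y v)" by force
  have f: "nzd L f" "weakly_regular (ideal_extend L f) fs" using Cons.prems by auto
  obtain e where "d = Suc e" "koszul_nontrivial y (ideal_extend L (f ^ k)) e"
    using koszul_nontrivial_step[OF Cons.prems(1) g nzd_power[OF f(1)] Cons.prems(3)] by blast
  moreover have "weakly_regular (ideal_extend L (f ^ k)) fs"
    by (rule weakly_regular_power_extend[OF Cons.prems(1) f])
  ultimately show ?case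
    using Cons.IH[of "ideal_extend L (f ^ k)" e] ideal_extend_is_ideal[OF Cons.prems(1)]
      Cons.prems(4) by simp
qed simp

section \<open>Products of linear forms, and powers inside the ideal of the Koszul complex\<close>

definition unit_cochain :: "'v list \<Rightarrow> 'a::comm_ring_1" where
  "unit_cochain vs = (if vs = [] then 1 else 0)"

text \<open>A product of forms with a repeated factor vanishes: by anticommutation \<open>y\<close>
  moves inward until it meets its own copy.\<close>

lemma koszul_foldr_member: "y \<in> set ys \<Longrightarrow> koszul y (foldr koszul ys z) vs = 0"
proof (induction ys arbitrary: vs)
  case (Cons y' ys)
  show ?case
  proof (cases "y = y'")
    case True
    then show ?thesis by (simp add: koszul_koszul)
  next
    case False
    then have "koszul y (foldr koszul ys z) = (\<lambda>vs. 0)" using Cons by auto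
    then have "koszul y' (koszul y (foldr koszul ys z)) vs = 0" by (simp add: koszul_zero)
    then show ?thesis by (simp add: koszul_anticommute[of y y'])
  qed
qed simp

text \<open>The value of the product of the forms \<open>fst p\<close> at the tuple of points
  \<open>snd q\<close> is the determinant of the matrix \<open>fst p (snd q)\<close>, which here is
  triangular.\<close>

lemma foldr_koszul_triangular:
  assumes "sorted_wrt (\<lambda>p q. fst p (snd q) = 0) ps"
  shows "foldr koszul (map fst ps) unit_cochain (map snd ps) = prod_list (map (\<lambda>p. fst p (snd p)) ps)"
  using assms
proof (induction ps)
  case (Cons p ps)
  have "koszul (fst p) z (map snd ps) = 0" for z
    using Cons.prems by (intro koszul_weight_zero) auto
  then show ?case using Cons by simp
qed (simp add: unit_cochain_def)

lemma ideal_combinations: "is_ideal {\<Sum>v\<in>(UNIV :: 'v::finite set). g v * y v | g. True}"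
proof (rule is_idealI)
  show "0 \<in> {\<Sum>v\<in>UNIV. g v * y v | g. True}"
    by (intro CollectI exI[of _ "\<lambda>v. 0"]) simp
next
  fix a b assume "a \<in> {\<Sum>v\<in>UNIV. g v * y v | g. True}" "b \<in> {\<Sum>v\<in>UNIV. g v * y v | g. True}"
  then obtain g h where "a = (\<Sum>v\<in>UNIV. g v * y v)" "b = (\<Sum>v\<in>UNIV. h v * y v)" by auto
  then have "a + b = (\<Sum>v\<in>UNIV. (g v + h v) * y v)" by (simp add: sum.distrib distrib_right)
  then show "a + b \<in> {\<Sum>v\<in>UNIV. g v * y v | g. True}"
    by (intro CollectI exI[of _ "\<lambda>v. g v + h v"]) simp
next
  fix r a assume "a \<in> {\<Sum>v\<in>UNIV. g v * y v | g. True}"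
  then obtain g where "a = (\<Sum>v\<in>UNIV. g v * y v)" by auto
  then have "r * a = (\<Sum>v\<in>UNIV. (r * g v) * y v)" by (simp add: sum_distrib_left mult.assoc)
  then show "r * a \<in> {\<Sum>v\<in>UNIV. g v * y v | g. True}"
    by (intro CollectI exI[of _ "\<lambda>v. r * g v"]) simp
qed

definition scaled_chi :: "nat \<Rightarrow> 'v::finite \<Rightarrow> ('v \<Rightarrow>\<^sub>0 nat)" where
  "scaled_chi m v = expo (\<lambda>x. if x = v then m else 0)"

lemma lk_scaled_chi [simp]: "lk (scaled_chi m v) x = (if x = v then m else 0)"
  by (simp add: scaled_chi_def)

lemma mono_dvd_scaled_chi: "mono_dvd (scaled_chi m v) b \<longleftrightarrow> m \<le> lk b v"
  by (auto simp: mono_dvd_def)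

lemma chi_insert: "v \<notin> A \<Longrightarrow> chi (insert v A) = chi {v} + chi A"
  by (rule poly_mapping_eqI) (auto simp: lookup_add)

lemma edeg_power:
  assumes "f \<in> var_ideal UNIV" "b \<in> Poly_Mapping.keys (f ^ k)"
  shows "k \<le> edeg b"
  using assms(2)
proof (induction k arbitrary: b)
  case (Suc k)
  then obtain c e where b: "b = c + e" and c: "c \<in> Poly_Mapping.keys f" "e \<in> Poly_Mapping.keys (f ^ k)"
    using keys_mult[of f "f ^ k"] by auto
  have "c \<in> var_exponents UNIV" using assms(1) c by (auto simp: var_ideal_def mono_ideal_def)
  then obtain v where "0 < lk c v" by (auto simp: var_exponents_def)
  then have "0 < edeg c" by (auto simp: edeg_def sum_pos2)
  then show ?case using Suc.IH[OF c(2)] by (simp add: b edeg_add)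
qed simp

text \<open>Pigeonhole: \<open>f\<close> has no constant term, so the monomials of
  \<open>f ^ k\<close> have degree at least k, and for k > n N one of the n exponents is at least
  N.\<close>

lemma power_in_combinations:
  fixes f :: "('v::finite, 'k::field) mpoly"
  assumes f: "f \<in> var_ideal UNIV" and m: "\<And>v. m v \<le> N"
  shows "\<exists>k g. f ^ k = (\<Sum>v\<in>UNIV. g v * mon (scaled_chi (m v) v))"
proof -
  let ?Y = "{\<Sum>v\<in>UNIV. g v * mon (scaled_chi (m v) v) | g. True} :: ('v, 'k) mpoly set"
  let ?k = "Suc (card (UNIV :: 'v set) * N)"
  have "f ^ ?k \<in> mono_ideal (Poly_Mapping.keys (f ^ ?k))" by (simp add: mono_ideal_def)
  also have "\<dots> \<subseteq> ?Y"
  proof (rule mono_ideal_subset[OF ideal_combinations])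
    fix b assume "b \<in> Poly_Mapping.keys (f ^ ?k)"
    then have le: "?k \<le> edeg b" by (rule edeg_power[OF f])
    have "\<exists>v. N \<le> lk b v"
    proof (rule ccontr)
      assume "\<nexists>v. N \<le> lk b v"
      then have "edeg b \<le> (\<Sum>v\<in>(UNIV :: 'v set). N)"
        unfolding edeg_def by (intro sum_mono) (simp add: not_le less_imp_le)
      then show False using le by simp
    qed
    then obtain v where "N \<le> lk b v" ..
    then have "mono_dvd (scaled_chi (m v) v) b" using m[of v] by (simp add: mono_dvd_scaled_chi)
    then obtain d where d: "b = scaled_chi (m v) v + d" by (auto simp: mono_dvd_iff)
    have "mon b = (\<Sum>x\<in>UNIV. (if x = v then mon d else 0) * mon (scaled_chi (m x) x) :: ('v, 'k) mpoly)"
      by (simp add: d if_distrib[of "\<lambda>p. p * _"] mult_single add.commute cong: if_cong)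
    then show "mon b \<in> ?Y"
      by (intro CollectI exI[of _ "\<lambda>x. if x = v then mon d else 0"]) simp
  qed
  finally show ?thesis by blast
qed

text \<open>Each factor \<open>D i\<close> contributes an endpoint of its edge to every monomial of
  the product.\<close>

lemma foldr_koszul_in_mono_ideal:
  fixes u w :: "nat \<Rightarrow> 'v::finite"
  defines "D \<equiv> \<lambda>i v. if v = u i \<or> v = w i then mon (chi {v}) else 0"
  shows "foldr koszul (map D is) z vs \<in>
    (mono_ideal {b. \<forall>i\<in>set is. 0 < lk b (u i) + lk b (w i)} :: ('v, 'k::field) mpoly set)"
proof (induction "is" arbitrary: vs)
  case Nil
  show ?case by (simp add: mono_ideal_def)
next
  case (Cons i "is")
  let ?B = "\<lambda>is. {b. \<forall>i\<in>set is. 0 < lk b (u i) + lk b (w i)}"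
  have "upclosed (?B (i # is))" by (auto simp: upclosed_def lookup_add)
  then have ideal: "is_ideal (mono_ideal (?B (i # is)) :: ('v, 'k) mpoly set)"
    by (rule mono_ideal_is_ideal)
  have "koszul (D i) (foldr koszul (map D is) z) vs \<in> (mono_ideal (?B (i # is)) :: ('v, 'k) mpoly set)"
  proof (rule koszul_induct[where Q = "\<lambda>p. p \<in> mono_ideal (?B (i # is))"])
    fix us v ws
    have IH: "foldr koszul (map D is) z (us @ ws) \<in> mono_ideal (?B is)" by (rule Cons.IH)
    show "D i v * foldr koszul (map D is) z (us @ ws) \<in> mono_ideal (?B (i # is))"
    proof (cases "v = u i \<or> v = w i")
      case True
      have "(+) (chi {v}) ` Poly_Mapping.keys (foldr koszul (map D is) z (us @ ws)) \<subseteq> ?B (i # is)"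
      proof (rule image_subsetI)
        fix b assume "b \<in> Poly_Mapping.keys (foldr koszul (map D is) z (us @ ws))"
        then have "b \<in> ?B is" by (rule subsetD[OF IH[unfolded mono_ideal_def mem_Collect_eq]])
        then show "chi {v} + b \<in> ?B (i # is)" using True by (auto simp: lookup_add)
      qed
      moreover have "D i v = mon (chi {v})" using True by (simp add: D_def)
      ultimately show ?thesis unfolding mono_ideal_def mem_Collect_eq by (simp only: keys_mon_mult)
    qed (simp add: D_def mono_ideal_def)
  next
    show "0 \<in> (mono_ideal (?B (i # is)) :: ('v, 'k) mpoly set)" by (rule ideal_zero[OF ideal])
    show "p - q \<in> mono_ideal (?B (i # is))"
      if "p \<in> mono_ideal (?B (i # is))" "q \<in> mono_ideal (?B (i # is))" for p q :: "('v, 'k) mpoly"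
      using that by (rule ideal_diff[OF ideal])
  qed
  then show ?case by simp
qed

text \<open>The cocycle \<open>z\<close> is \<open>x\<^sup>a\<close> times the wedge product of the forms \<open>D i\<close> for \<open>i < r\<close> with the unit forms of
  the unmatched vertices, and its coboundary \<open>\<eta>\<close> has values in the ideal. If \<open>z = \<delta> x + l\<close> with \<open>l\<close> valued in the
  ideal then \<open>\<delta> l = \<eta>\<close>, which fails in a single coefficient \<open>\<beta>\<close> at a single tuple \<open>vs0\<close>.\<close>

lemma koszul_nontrivial_cover:
  fixes u w :: "nat \<Rightarrow> 'v::finite" and E :: "'v set set" and a :: "'v \<Rightarrow>\<^sub>0 nat"
  assumes r: "1 \<le> r"
    and inj: "inj_on u {1..r}" "inj_on w {1..r}" "\<And>i j. i \<in> {1..r} \<Longrightarrow> j \<in> {1..r} \<Longrightarrow> u i \<noteq> w j"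
    and pair: "\<And>i. i \<in> {1..r} \<Longrightarrow> {u i, w i} \<in> E" "\<And>i. i \<in> {1..r} \<Longrightarrow> Suc (lk a (u i) + lk a (w i)) = k"
    and other: "\<And>p q. {p, q} \<in> E \<Longrightarrow> lk a p + lk a q < k \<Longrightarrow> \<exists>i\<in>{1..r}. {p, q} = {u i, w i}"
    and rest: "\<And>v. v \<notin> u ` {1..r} \<union> w ` {1..r} \<Longrightarrow> lk a v = k"
  shows "koszul_nontrivial
    (\<lambda>v. mon (scaled_chi (if v \<in> u ` {1..r} \<union> w ` {1..r} then 1 else Suc k) v) :: ('v, 'k::field) mpoly)
    (mono_ideal (cover_exponents E k (\<lambda>_. 0) {})) (card (UNIV :: 'v set) - r - 1)"
proof -
  let ?C = "- (u ` {1..r} \<union> w ` {1..r})"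
  obtain cs where cs: "set cs = ?C" "distinct cs" using finite_distinct_list[of ?C] by auto
  let ?M = "\<lambda>b. mon b :: ('v, 'k) mpoly"
  let ?I = "mono_ideal (cover_exponents E k (\<lambda>_. 0) {}) :: ('v, 'k) mpoly set"
  define y where "y = (\<lambda>v. ?M (scaled_chi (if v \<in> u ` {1..r} \<union> w ` {1..r} then 1 else Suc k) v))"
  define D where "D = (\<lambda>i v. if v = u i \<or> v = w i then ?M (chi {v}) else 0)"
  define e where "e = (\<lambda>(c :: 'v) v. if v = c then 1 else 0 :: ('v, 'k) mpoly)"
  \<comment> \<open>The indices are reversed so that \<open>D r\<close> is the outermost factor, the
    one that distinguishes \<eta> from \<open>z\<close>.\<close>
  define F where "F m = foldr koszul (map D (rev [1..<Suc m]) @ map e cs) unit_cochain" for m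
  define z where "z = (\<lambda>vs. ?M a * F (r - 1) vs)"
  define \<eta> where "\<eta> = (\<lambda>vs. ?M a * F r vs)"
  \<comment> \<open>At \<open>vs0\<close> the matrix of the forms is triangular, with the variables
    \<open>w i\<close> and then ones on its diagonal; so \<eta> takes there the single monomial with
    exponent \<beta>.\<close>
  define vs0 where "vs0 = map w (rev [1..<Suc r]) @ cs"
  define \<beta> where "\<beta> = a + chi (w ` {1..r})"
  have chi1: "scaled_chi 1 v = chi {v}" for v :: 'v
    by (rule poly_mapping_eqI) simp

  have Fr: "F r = koszul (D r) (F (r - 1))"
  proof -
    have "rev [1..<Suc r] = r # rev [1..<Suc (r - 1)]" using r by simp
    then show ?thesis by (simp only: F_def list.map append_Cons foldr.simps comp_def)
  qed
  have y_eq: "y = (\<lambda>v. (\<Sum>i\<in>{1..r}. D i v) + (\<Sum>c\<in>?C. ?M (scaled_chi (Suc k) c) * e c v))"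
  proof
    fix v
    have C: "(\<Sum>c\<in>?C. ?M (scaled_chi (Suc k) c) * e c v) =
        (if v \<in> ?C then ?M (scaled_chi (Suc k) v) else 0)"
      unfolding e_def by (simp add: if_distrib[of "\<lambda>p. _ * p"] cong: if_cong)
    show "y v = (\<Sum>i\<in>{1..r}. D i v) + (\<Sum>c\<in>?C. ?M (scaled_chi (Suc k) c) * e c v)"
    proof (cases "v \<in> ?C")
      case True
      then have "D i v = 0" if "i \<in> {1..r}" for i using that by (auto simp: D_def)
      then show ?thesis using True unfolding C by (simp add: y_def)
    next
      case False
      then obtain j where j: "j \<in> {1..r}" "v = u j \<or> v = w j" by blast
      have "D i v = (if i = j then ?M (chi {v}) else 0)" if "i \<in> {1..r}" for i
      proof -
        have "u i = u j \<longleftrightarrow> i = j" "w i = w j \<longleftrightarrow> i = j" "u i \<noteq> w j" "w i \<noteq> u j"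
          using that j inj(3)[of i j] inj(3)[of j i] inj_on_eq_iff[OF inj(1)] inj_on_eq_iff[OF inj(2)]
          by auto
        then show ?thesis using j(2) by (auto simp: D_def)
      qed
      then have "(\<Sum>i\<in>{1..r}. D i v) = (\<Sum>i\<in>{1..r}. if i = j then ?M (chi {v}) else 0)"
        by (intro sum.cong) auto
      also have "\<dots> = ?M (chi {v})" using j by simp
      finally have S: "(\<Sum>i\<in>{1..r}. D i v) = ?M (chi {v})" .
      have "y v = ?M (chi {v})" using False by (simp add: y_def flip: chi1)
      then show ?thesis using False unfolding C S by (simp only: if_False add_0_right)
    qed
  qed
  \<comment> \<open>Of the forms that make up \<open>y\<close>, only \<open>D r\<close> is not yet a
    factor of \<open>F (r - 1)\<close>; the products with all others vanish.\<close>
  have dz: "koszul y z vs = \<eta> vs" for vs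
  proof -
    have 1: "koszul (D i) (F (r - 1)) vs = (if i = r then F r vs else 0)" if "i \<in> {1..r}" for i
    proof (cases "i = r")
      case False
      then have "D i \<in> set (map D (rev [1..<Suc (r - 1)]) @ map e cs)" using that by auto
      then show ?thesis using False unfolding F_def by (simp only: koszul_foldr_member if_False)
    qed (simp add: Fr)
    have 2: "koszul (e c) (F (r - 1)) vs = 0" if "c \<in> ?C" for c
      unfolding F_def by (rule koszul_foldr_member) (use that cs in auto)
    have "koszul y (F (r - 1)) vs = (\<Sum>i\<in>{1..r}. koszul (D i) (F (r - 1)) vs) +
        (\<Sum>c\<in>?C. ?M (scaled_chi (Suc k) c) * koszul (e c) (F (r - 1)) vs)"
      unfolding y_eq koszul_weight_add koszul_weight_sum koszul_weight_mult ..
    also have "\<dots> = (\<Sum>i\<in>{1..r}. if i = r then F r vs else 0) + (\<Sum>c\<in>?C. 0)"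
      using 1 2 by (intro arg_cong2[of _ _ _ _ "(+)"] sum.cong) auto
    also have "\<dots> = F r vs" using r by simp
    finally show ?thesis by (simp add: z_def \<eta>_def koszul_mult)
  qed
  \<comment> \<open>On the edges where \<open>a\<close> falls short of k it does so by exactly one,
    and \<open>F r\<close> supplies a variable on each of them.\<close>
  have \<eta>_I: "\<eta> vs \<in> ?I" for vs
  proof -
    have "F r vs \<in> mono_ideal {b. \<forall>i\<in>set (rev [1..<Suc r]). 0 < lk b (u i) + lk b (w i)}"
      unfolding F_def foldr_append D_def by (rule foldr_koszul_in_mono_ideal)
    moreover have "a + b \<in> cover_exponents E k (\<lambda>_. 0) {}"
      if b: "\<forall>i\<in>set (rev [1..<Suc r]). 0 < lk b (u i) + lk b (w i)" for b
    proof -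
      have "k \<le> lk a p + lk b p + (lk a q + lk b q)" if pq: "{p, q} \<in> E" for p q
      proof (cases "lk a p + lk a q < k")
        case True
        then obtain i where i: "i \<in> {1..r}" "{p, q} = {u i, w i}" using other pq by blast
        then have "0 < lk b (u i) + lk b (w i)" using b by (simp del: upt_Suc)
        then have "Suc (lk a p + lk a q) = k" "0 < lk b p + lk b q"
          using i(2) pair(2)[OF i(1)] by (auto simp: doubleton_eq_iff add.commute)
        then show ?thesis by linarith
      qed simp
      then show ?thesis by (simp add: cover_exponents_def lookup_add)
    qed
    ultimately show ?thesis
      by (auto simp: \<eta>_def mono_ideal_def keys_mon_mult)
  qed
  have \<eta>0: "\<eta> vs0 = ?M \<beta>"
  proof -
    define ps where "ps = map (\<lambda>i. (D i, w i)) (rev [1..<Suc r]) @ map (\<lambda>c. (e c, c)) cs"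
    have fst: "map fst ps = map D (rev [1..<Suc r]) @ map e cs"
      and snd: "map snd ps = vs0" by (simp_all add: ps_def vs0_def o_def del: upt_Suc)
    have "sorted_wrt (\<lambda>p q. fst p (snd q) = 0) ps"
    proof -
      have "sorted_wrt (\<lambda>i j. D i (w j) = 0) (rev [1..<Suc r])"
        unfolding sorted_wrt_rev
      proof (rule sorted_wrt_mono_rel[OF _ sorted_wrt_upt])
        fix i j assume "i \<in> set [1..<Suc r]" "j \<in> set [1..<Suc r]" "i < j"
        then have "i \<in> {1..r}" "j \<in> {1..r}" "i \<noteq> j" by (auto simp del: upt_Suc)
        then have "w i \<noteq> u j" "w i \<noteq> w j" using inj(3)[of j i] inj_on_eq_iff[OF inj(2)] by auto
        then show "D j (w i) = 0" by (simp add: D_def)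
      qed
      moreover have "sorted_wrt (\<lambda>c c'. e c c' = 0) cs"
        using cs(2) by (auto simp: sorted_wrt_iff_nth_less e_def nth_eq_iff_index_eq)
      moreover have "D i c = 0" if "i \<in> {1..r}" "c \<in> set cs" for i c
        using that cs by (auto simp: D_def)
      ultimately show ?thesis
        by (auto simp: ps_def sorted_wrt_append sorted_wrt_map)
    qed
    from foldr_koszul_triangular[OF this]
    have "F r vs0 = prod_list (map (\<lambda>p. fst p (snd p)) ps)"
      unfolding fst snd F_def .
    also have "\<dots> = prod_list (map (\<lambda>i. ?M (chi {w i})) (rev [1..<Suc r]))"
      by (simp add: ps_def o_def D_def e_def map_replicate_const prod_list_replicate del: upt_Suc)
    also have "\<dots> = ?M (chi (w ` {1..r}))"
    proof -
      have "prod_list (map (\<lambda>i. ?M (chi {w i})) (rev [1..<Suc m])) = ?M (chi (w ` {1..m}))"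
        if "m \<le> r" for m
        using that
      proof (induction m)
        case 0
        have "chi {} = (0 :: 'v \<Rightarrow>\<^sub>0 nat)" by (rule poly_mapping_eqI) simp
        then show ?case by simp
      next
        case (Suc m)
        have "w (Suc m) \<notin> w ` {1..m}"
          using Suc.prems inj(2) by (auto dest!: inj_onD)
        then have "chi (insert (w (Suc m)) (w ` {1..m})) = chi {w (Suc m)} + chi (w ` {1..m})"
          by (rule chi_insert)
        moreover have "w ` {1..Suc m} = insert (w (Suc m)) (w ` {1..m})"
          by (simp add: atLeastAtMostSuc_conv)
        ultimately have "chi (w ` {1..Suc m}) = chi {w (Suc m)} + chi (w ` {1..m})"
          by (simp only:)
        then show ?case using Suc by (simp add: mult_single)
      qed
      then show ?thesis by simp
    qed
    finally show ?thesis by (simp add: \<eta>_def \<beta>_def mult_single)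
  qed
  \<comment> \<open>Thus \<open>vs0\<close> has r + (n - 2 r) = n - r entries, one more than the
    degree of \<open>z\<close>.\<close>
  have card: "length cs + 2 * r = card (UNIV :: 'v set)"
  proof -
    have "card (u ` {1..r} \<union> w ` {1..r}) = r + r"
      using inj by (subst card_Un_disjoint) (auto simp: card_image)
    then have "card ?C = card (UNIV :: 'v set) - (r + r)"
      by (simp add: Compl_eq_Diff_UNIV card_Diff_subset)
    moreover have "r + r \<le> card (UNIV :: 'v set)"
      using \<open>card (u ` {1..r} \<union> w ` {1..r}) = r + r\<close> card_mono[of UNIV "u ` {1..r} \<union> w ` {1..r}"] by simp
    moreover have "length cs = card ?C" using distinct_card[OF cs(2)] cs(1) by simp
    ultimately show ?thesis by simp
  qed
  have set_vs0: "set vs0 = w ` {1..r} \<union> ?C"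
    by (simp add: vs0_def cs atLeastLessThanSuc_atLeastAtMost del: upt_Suc)
  have "\<not> (\<forall>vs. length vs = card (UNIV :: 'v set) - r - 1 \<longrightarrow> z vs - koszul y x vs \<in> ?I)" for x
  proof
    assume x: "\<forall>vs. length vs = card (UNIV :: 'v set) - r - 1 \<longrightarrow> z vs - koszul y x vs \<in> ?I"
    define l where "l = (\<lambda>vs. z vs - koszul y x vs)"
    have "koszul y l vs0 = ?M \<beta>"
      unfolding l_def by (simp add: koszul_diff koszul_koszul dz \<eta>0)
    moreover have "lk (koszul y l vs0) \<beta> = 0"
    proof (rule koszul_induct[where Q = "\<lambda>p. lk p \<beta> = 0"])
      fix us v ws assume vs0: "vs0 = us @ v # ws"
      have "length vs0 = r + length cs" by (simp add: vs0_def del: upt_Suc)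
      moreover have "length vs0 = Suc (length us + length ws)" by (simp add: vs0)
      ultimately have "length (us @ ws) = card (UNIV :: 'v set) - r - 1"
        using card by simp
      then have l: "l (us @ ws) \<in> ?I" using x by (simp add: l_def)
      have "v \<in> set vs0" using vs0 by simp
      then consider (pair) i where "i \<in> {1..r}" "v = w i" | (rest) "v \<in> ?C"
        unfolding set_vs0 by blast
      then show "lk (y v * l (us @ ws)) \<beta> = 0"
      proof cases
        case pair
        \<comment> \<open>Without its \<open>w i\<close> the exponent \<beta> agrees with
          \<open>a\<close> on the edge of index i, where \<open>a\<close> has total k - 1.\<close>
        have "\<beta> - chi {w i} \<notin> cover_exponents E k (\<lambda>_. 0) {}"
        proof
          assume "\<beta> - chi {w i} \<in> cover_exponents E k (\<lambda>_. 0) {}"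
          then have "k \<le> lk (\<beta> - chi {w i}) (u i) + lk (\<beta> - chi {w i}) (w i)"
            using \<open>i \<in> {1..r}\<close> assms(5)[of i] by (auto simp: cover_exponents_def var_exponents_def)
          moreover have "u i \<notin> w ` {1..r}" using inj(3) pair by blast
          ultimately show False
            using \<open>i \<in> {1..r}\<close> assms(6)[of i] inj(3)[of i i]
            by (auto simp: \<beta>_def lookup_add lookup_minus)
        qed
        then have "lk (l (us @ ws)) (\<beta> - chi {w i}) = 0"
          using l by (auto simp: mono_ideal_def in_keys_iff)
        moreover have "y v = ?M (chi {w i})" using pair by (simp add: y_def flip: chi1)
        ultimately show ?thesis by (simp add: lookup_single_mult)
      next
        case rest
        \<comment> \<open>Here the weight \<open>Suc k\<close> of the unmatched vertices pays off:
          \<beta> has exponent k at v, so no multiple of the weight contributes.\<close>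
        then have "lk \<beta> v = k" using assms(8)[of v] by (auto simp: \<beta>_def lookup_add)
        then have "\<not> mono_dvd (scaled_chi (Suc k) v) \<beta>" by (simp add: mono_dvd_scaled_chi)
        then show ?thesis using rest by (simp add: y_def lookup_single_mult)
      qed
    qed (simp_all add: lookup_minus)
    ultimately show False by simp
  qed
  then show ?thesis
    unfolding koszul_nontrivial_def y_def[symmetric] using dz \<eta>_I by (intro exI[of _ z]) auto
qed

section \<open>The quotient modules\<close>

lemma mpoly_ring_simps [simp]:
  "carrier mpoly_ring = UNIV" "x \<otimes>\<^bsub>mpoly_ring\<^esub> y = x * y" "\<one>\<^bsub>mpoly_ring\<^esub> = 1"
  "\<zero>\<^bsub>mpoly_ring\<^esub> = 0" "x \<oplus>\<^bsub>mpoly_ring\<^esub> y = x + y"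
  by (simp_all add: mpoly_ring_def)

lemma cring_mpoly_ring: "cring (mpoly_ring :: ('v, 'k::field) mpoly ring)"
proof (rule cringI)
  show "abelian_group (mpoly_ring :: ('v, 'k) mpoly ring)"
    by (rule abelian_groupI)
      (auto simp: add.assoc add.commute intro: exI[of _ "- x" for x] left_minus)
  show "comm_monoid (mpoly_ring :: ('v, 'k) mpoly ring)"
    by (rule comm_monoidI) (simp_all add: mult.assoc mult.commute)
qed (simp add: distrib_right)

text \<open>Up to here ideals are plain sets in a type-class ring; this equivalence carries the
  results over to the algebraic structures in which depth is defined.\<close>

lemma ideal_iff_is_ideal: "ideal I mpoly_ring \<longleftrightarrow> is_ideal (I :: ('v, 'k::field) mpoly set)"
proof
  assume I: "ideal I mpoly_ring"
  have A: "additive_subgroup I mpoly_ring" by (rule ideal.axioms(1)[OF I])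
  show "is_ideal I"
  proof (rule is_idealI)
    show "0 \<in> I" using additive_subgroup.zero_closed[OF A] by simp
    show "a + b \<in> I" if "a \<in> I" "b \<in> I" for a b
      using additive_subgroup.a_closed[OF A that] by simp
    show "r * a \<in> I" if "a \<in> I" for r a
      using ideal.I_l_closed[OF I that, of r] by simp
  qed
next
  assume I: "is_ideal I"
  interpret R: cring "mpoly_ring :: ('v, 'k) mpoly ring" by (rule cring_mpoly_ring)
  show "ideal I mpoly_ring"
  proof (rule idealI)
    show "subgroup I (add_monoid mpoly_ring)"
    proof (rule R.add.subgroupI)
      fix a assume a: "a \<in> I"
      have "\<ominus>\<^bsub>mpoly_ring\<^esub> a = - a"
        by (rule R.minus_equality) simp_all
      then show "\<ominus>\<^bsub>mpoly_ring\<^esub> a \<in> I" using ideal_uminus[OF I a] by simp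
    qed (use ideal_zero[OF I] ideal_add[OF I] in auto)
    show "x \<otimes>\<^bsub>mpoly_ring\<^esub> a \<in> I" "a \<otimes>\<^bsub>mpoly_ring\<^esub> x \<in> I" if "a \<in> I" for a x
      using ideal_mult[OF I that, of x] ideal_mult_right[OF I that, of x] by simp_all
  qed (rule R.ring_axioms)
qed

abbreviation residue :: "('v, 'k::field) mpoly set \<Rightarrow> ('v, 'k) mpoly \<Rightarrow> ('v, 'k) mpoly set" where
  "residue I f \<equiv> I +>\<^bsub>mpoly_ring\<^esub> f"

abbreviation quot :: "('v, 'k::field) mpoly set \<Rightarrow> (('v, 'k) mpoly, ('v, 'k) mpoly set) module" where
  "quot I \<equiv> quot_module mpoly_ring I"

lemma mem_residue_iff: "g \<in> residue I f \<longleftrightarrow> g - f \<in> I"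
proof -
  have "g \<in> residue I f \<longleftrightarrow> (\<exists>h\<in>I. g = h + f)" by (simp add: a_r_coset_def')
  also have "\<dots> \<longleftrightarrow> g - f \<in> I" by (metis add_diff_cancel diff_add_cancel)
  finally show ?thesis .
qed

lemma residue_eq_iff:
  assumes "is_ideal I"
  shows "residue I f = residue I g \<longleftrightarrow> f - g \<in> I"
proof
  assume "residue I f = residue I g"
  moreover have "f \<in> residue I f" using ideal_zero[OF assms] by (simp add: mem_residue_iff)
  ultimately show "f - g \<in> I" by (simp add: mem_residue_iff)
next
  assume fg: "f - g \<in> I"
  have "h - f \<in> I \<longleftrightarrow> h - g \<in> I" for h
    using ideal_diff_mem_iff[OF assms, of "h - g" "h - f"] fg by simp
  then show "residue I f = residue I g" by (auto simp: mem_residue_iff)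
qed

lemma residue_zero: "residue I 0 = I"
  by (auto simp: mem_residue_iff)

lemma quot_simps:
  assumes "is_ideal I"
  shows "carrier (quot I) = range (residue I)"
    and "residue I f \<oplus>\<^bsub>quot I\<^esub> residue I g = residue I (f + g)"
    and "\<zero>\<^bsub>quot I\<^esub> = residue I 0"
    and "r \<odot>\<^bsub>quot I\<^esub> residue I f = residue I (r * f)"
proof -
  interpret ideal I mpoly_ring using assms by (simp add: ideal_iff_is_ideal)
  show "carrier (quot I) = range (residue I)"
    by (auto simp: quot_module_def FactRing_def A_RCOSETS_def')
  show "residue I f \<oplus>\<^bsub>quot I\<^esub> residue I g = residue I (f + g)"
    using a_rcos_sum[of f g] by (simp add: quot_module_def FactRing_def)
  show "\<zero>\<^bsub>quot I\<^esub> = residue I 0"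
    by (simp add: quot_module_def FactRing_def residue_zero)
  show "r \<odot>\<^bsub>quot I\<^esub> residue I f = residue I (r * f)"
    using rcoset_mult_add[of r f] by (simp add: quot_module_def FactRing_def)
qed

lemma group_quot:
  assumes "is_ideal I"
  shows "group (add_monoid (quot I))"
proof (rule abelian_group.a_group, rule abelian_groupI)
  fix x assume "x \<in> carrier (quot I)"
  then obtain f where "x = residue I f" by (auto simp: quot_simps[OF assms])
  then have "residue I (- f) \<oplus>\<^bsub>quot I\<^esub> x = \<zero>\<^bsub>quot I\<^esub>"
    by (simp add: quot_simps[OF assms])
  then show "\<exists>y\<in>carrier (quot I). y \<oplus>\<^bsub>quot I\<^esub> x = \<zero>\<^bsub>quot I\<^esub>"
    by (intro bexI[of _ "residue I (- f)"]) (simp_all add: quot_simps[OF assms])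
qed (auto simp: quot_simps[OF assms] add.assoc add.commute add.left_commute)

text \<open>The correspondence theorem. It identifies the intersection in
  \<open>seq_submodule\<close> with the image of an iterated ideal extension.\<close>

lemma quot_submodule_iff:
  assumes I: "is_ideal I"
  shows "submodule N mpoly_ring (quot I) \<longleftrightarrow>
    (\<exists>K. is_ideal K \<and> I \<subseteq> K \<and> N = residue I ` K)"
proof
  assume "submodule N mpoly_ring (quot I)"
  then interpret submodule N mpoly_ring "quot I" .
  let ?K = "{f. residue I f \<in> N}"
  have N: "N \<subseteq> range (residue I)" using subset by (simp add: quot_simps[OF I])
  have "is_ideal ?K"
  proof (rule is_idealI)
    show "0 \<in> ?K" using one_closed by (simp add: quot_simps[OF I])
    show "f + g \<in> ?K" if "f \<in> ?K" "g \<in> ?K" for f g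
      using m_closed[of "residue I f" "residue I g"] that by (simp add: quot_simps[OF I])
    show "r * f \<in> ?K" if "f \<in> ?K" for r f
      using smult_closed[of r "residue I f"] that by (simp add: quot_simps[OF I])
  qed
  moreover have "I \<subseteq> ?K"
  proof
    fix f assume "f \<in> I"
    then have "residue I f = residue I 0" by (simp add: residue_eq_iff[OF I])
    then show "f \<in> ?K" using one_closed by (simp add: quot_simps[OF I])
  qed
  moreover have "N = residue I ` ?K" using N by auto
  ultimately show "\<exists>K. is_ideal K \<and> I \<subseteq> K \<and> N = residue I ` K" by blast
next
  assume "\<exists>K. is_ideal K \<and> I \<subseteq> K \<and> N = residue I ` K"
  then obtain K where K: "is_ideal K" "I \<subseteq> K" and N: "N = residue I ` K" by blast
  interpret G: group "add_monoid (quot I)" by (rule group_quot[OF I])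
  show "submodule N mpoly_ring (quot I)"
  proof (intro submodule.intro submodule_axioms.intro G.subgroupI)
    show "N \<subseteq> carrier (add_monoid (quot I))" by (auto simp: N quot_simps[OF I])
    show "N \<noteq> {}" using ideal_zero[OF K(1)] by (auto simp: N)
    show "inv\<^bsub>add_monoid (quot I)\<^esub> x \<in> N" if x: "x \<in> N" for x
    proof -
      obtain f where f: "f \<in> K" "x = residue I f" using x unfolding N by blast
      have "inv\<^bsub>add_monoid (quot I)\<^esub> x = residue I (- f)"
        by (rule G.inv_equality) (simp_all add: f quot_simps[OF I])
      then show ?thesis using ideal_uminus[OF K(1) f(1)] by (simp add: N)
    qed
    show "x \<otimes>\<^bsub>add_monoid (quot I)\<^esub> y \<in> N" if "x \<in> N" "y \<in> N" for x y
      using that ideal_add[OF K(1)] by (auto simp: N quot_simps[OF I])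
    show "a \<odot>\<^bsub>quot I\<^esub> x \<in> N" if "a \<in> carrier mpoly_ring" "x \<in> N" for a x
      using that ideal_mult[OF K(1)] by (auto simp: N quot_simps[OF I])
  qed
qed

lemma residue_mem_image_iff:
  assumes "is_ideal K" "I \<subseteq> K" "is_ideal I"
  shows "residue I f \<in> residue I ` K \<longleftrightarrow> f \<in> K"
proof
  assume "residue I f \<in> residue I ` K"
  then obtain g where "g \<in> K" "f - g \<in> I" by (auto simp: residue_eq_iff[OF assms(3)])
  then show "f \<in> K" using ideal_diff_mem_iff[OF assms(1)] assms(2) by blast
qed auto

lemma seq_submodule_quot:
  assumes I: "is_ideal I"
  shows "seq_submodule mpoly_ring (quot I) fs = residue I ` foldl ideal_extend I fs"
proof -
  let ?K = "foldl ideal_extend I fs"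
  have K: "is_ideal ?K" "I \<subseteq> ?K"
    using foldl_extend_is_ideal[OF I] foldl_extend_superset by auto
  have "submodule (residue I ` ?K) mpoly_ring (quot I)"
    using quot_submodule_iff[OF I] K by blast
  moreover have "f \<odot>\<^bsub>quot I\<^esub> x \<in> residue I ` ?K" if "f \<in> set fs" "x \<in> carrier (quot I)" for f x
    using that foldl_extend_mem[OF I that(1)] ideal_mult_right[OF K(1)]
    by (auto simp: quot_simps[OF I])
  moreover have "residue I ` ?K \<subseteq> N"
    if N: "submodule N mpoly_ring (quot I)" "\<And>f x. f \<in> set fs \<Longrightarrow> x \<in> carrier (quot I) \<Longrightarrow> f \<odot>\<^bsub>quot I\<^esub> x \<in> N"
    for N
  proof -
    obtain K' where K': "is_ideal K'" "I \<subseteq> K'" "N = residue I ` K'"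
      using N(1) quot_submodule_iff[OF I] by blast
    have "f \<in> K'" if "f \<in> set fs" for f
    proof -
      have "residue I f \<in> N"
        using N(2)[OF that, of "residue I 1"] by (simp add: quot_simps[OF I])
      then show ?thesis using residue_mem_image_iff[OF K'(1,2) I] by (simp add: K'(3))
    qed
    then have "?K \<subseteq> K'" using K' by (intro foldl_extend_least) auto
    then show ?thesis using K'(3) by blast
  qed
  ultimately show ?thesis
    unfolding seq_submodule_def by (intro equalityI Inter_lower Inter_greatest) auto
qed

lemma regular_sequence_quot_iff:
  assumes I: "is_ideal I"
  shows "regular_sequence mpoly_ring (quot I) fs \<longleftrightarrow>
    weakly_regular I fs \<and> foldl ideal_extend I fs \<noteq> UNIV"
proof -
  let ?K = "\<lambda>i. foldl ideal_extend I (take i fs)"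
  have mem: "residue I f \<in> residue I ` foldl ideal_extend I gs \<longleftrightarrow> f \<in> foldl ideal_extend I gs" for f gs
    using residue_mem_image_iff foldl_extend_is_ideal[OF I] foldl_extend_superset I by metis
  have "(\<forall>i<length fs. \<forall>x\<in>carrier (quot I).
        (fs ! i) \<odot>\<^bsub>quot I\<^esub> x \<in> seq_submodule mpoly_ring (quot I) (take i fs) \<longrightarrow>
        x \<in> seq_submodule mpoly_ring (quot I) (take i fs)) \<longleftrightarrow> weakly_regular I fs"
    unfolding weakly_regular_iff_nth nzd_def seq_submodule_quot[OF I]
    by (simp add: quot_simps[OF I] mem)
  moreover have "seq_submodule mpoly_ring (quot I) fs \<noteq> carrier (quot I) \<longleftrightarrow> foldl ideal_extend I fs \<noteq> UNIV"
    unfolding seq_submodule_quot[OF I] quot_simps[OF I] using mem[of _ fs]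
    by (metis UNIV_eq_I rangeI)
  ultimately show ?thesis by (simp add: regular_sequence_def)
qed

lemma genideal_vars: "genideal mpoly_ring (mpoly_var ` A) = (var_ideal A :: ('v::finite, 'k::field) mpoly set)"
  unfolding genideal_def ideal_iff_is_ideal
proof (intro equalityI Inter_lower Inter_greatest)
  show "var_ideal A \<in> {I. is_ideal I \<and> mpoly_var ` A \<subseteq> (I :: ('v, 'k) mpoly set)}"
    using var_ideal_is_ideal[of A]
    by (auto simp: mpoly_var_eq var_ideal_def var_exponents_def)
  fix I :: "('v, 'k) mpoly set" assume "I \<in> {I. is_ideal I \<and> mpoly_var ` A \<subseteq> I}"
  then have I: "is_ideal I" "\<And>v. v \<in> A \<Longrightarrow> mon (chi {v}) \<in> I"
    by (auto simp: mpoly_var_eq)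
  show "var_ideal A \<subseteq> I"
    unfolding var_ideal_def
  proof (rule mono_ideal_subset[OF I(1)])
    fix b :: "'v \<Rightarrow>\<^sub>0 nat" assume "b \<in> var_exponents A"
    then obtain v where v: "v \<in> A" "mono_dvd (chi {v}) b"
      by (auto simp: var_exponents_def mono_dvd_chi)
    then obtain d where "b = chi {v} + d" by (auto simp: mono_dvd_iff)
    then show "mon b \<in> I"
      using ideal_mult_right[OF I(1) I(2)[OF v(1)], of "mon d"] by (simp add: mult_single)
  qed
qed

lemma graded_maximal_ideal_eq: "graded_maximal_ideal = (var_ideal UNIV :: ('v::finite, 'k::field) mpoly set)"
  unfolding graded_maximal_ideal_def by (rule genideal_vars)

section \<open>Symbolic powers of the cover ideal\<close>

text \<open>A substitute for a monomial order: some pair of elements has a sum that is attained only once.\<close>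

lemma unique_sum_pair:
  fixes S T :: "('v::finite \<Rightarrow>\<^sub>0 nat) set"
  assumes "finite S" "finite T" "S \<noteq> {}" "T \<noteq> {}"
  shows "\<exists>b\<in>S. \<exists>c\<in>T. \<forall>b'\<in>S. \<forall>c'\<in>T. b' + c' = b + c \<longrightarrow> b' = b \<and> c' = c"
proof -
  let ?agree = "\<lambda>W S'. \<forall>x\<in>W. \<forall>b\<in>S'. \<forall>b'\<in>S'. lk b x = lk b' x"
  let ?closed = "\<lambda>S' T'. \<forall>b\<in>S'. \<forall>c\<in>T'. \<forall>b'\<in>S. \<forall>c'\<in>T. b' + c' = b + c \<longrightarrow> b' \<in> S' \<and> c' \<in> T'"
  let ?P = "\<lambda>W S' T'. (S' \<noteq> {} \<and> S' \<subseteq> S \<and> T' \<noteq> {} \<and> T' \<subseteq> T) \<and> ?agree W S' \<and> ?agree W T' \<and> ?closed S' T'"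
  have "\<exists>S' T'. ?P W S' T'" if "finite W" for W :: "'v set"
    using that
  proof (induction W)
    case empty
    show ?case by (rule exI[of _ S], rule exI[of _ T]) (use assms in simp)
  next
    case (insert v W)
    then obtain S' T' where IH: "?P W S' T'" by (elim exE)
    have ne: "S' \<noteq> {}" "T' \<noteq> {}" and sub: "S' \<subseteq> S" "T' \<subseteq> T"
      using conjunct1[OF IH] by simp_all
    note agree = conjunct1[OF conjunct2[OF IH]] conjunct1[OF conjunct2[OF conjunct2[OF IH]]]
    and closed = conjunct2[OF conjunct2[OF conjunct2[OF IH]]]
    \<comment> \<open>One coordinate of a lexicographic comparison: a sum that is maximal at v
      arises only from summands that are both maximal at v, so \<open>?closed\<close> survives the
      restriction to them.\<close>
    define m n where "m = Max ((\<lambda>b. lk b v) ` S')" and "n = Max ((\<lambda>c. lk c v) ` T')"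
    let ?S = "{b \<in> S'. lk b v = m}" and ?T = "{c \<in> T'. lk c v = n}"
    have fin: "finite S'" "finite T'" using sub assms finite_subset by auto
    have le: "lk b v \<le> m" if "b \<in> S'" for b unfolding m_def using fin that by simp
    have le': "lk c v \<le> n" if "c \<in> T'" for c unfolding n_def using fin that by simp
    have "m \<in> (\<lambda>b. lk b v) ` S'" unfolding m_def using fin ne by (intro Max_in) auto
    moreover have "n \<in> (\<lambda>c. lk c v) ` T'" unfolding n_def using fin ne by (intro Max_in) auto
    ultimately have ne': "?S \<noteq> {}" "?T \<noteq> {}" by auto
    have "b' \<in> ?S \<and> c' \<in> ?T"
      if h: "b \<in> ?S" "c \<in> ?T" "b' \<in> S" "c' \<in> T" "b' + c' = b + c" for b c b' c'
    proof -
      have bc: "b \<in> S'" "c \<in> T'" "lk b v = m" "lk c v = n" using h by simp_all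
      have *: "b' \<in> S'" "c' \<in> T'" using closed bc(1,2) h(3-5) by blast+
      have "lk b' v + lk c' v = m + n"
        using arg_cong[OF h(5), of "\<lambda>d. lk d v"] bc(3,4) by (simp add: lookup_add)
      then have "lk b' v = m" "lk c' v = n" using le[OF *(1)] le'[OF *(2)] by linarith+
      then show ?thesis using * by simp
    qed
    then have "?closed ?S ?T" by (intro ballI impI)
    moreover have "?agree (insert v W) ?S" "?agree (insert v W) ?T" using agree by simp_all
    moreover have "?S \<subseteq> S" "?T \<subseteq> T" using sub by auto
    ultimately have "?P (insert v W) ?S ?T" using ne' by (intro conjI)
    then show ?case by (intro exI)
  qed
  from this[of UNIV, OF finite] obtain S' T' where P: "?P UNIV S' T'" by (elim exE)
  have ne: "S' \<noteq> {}" "T' \<noteq> {}" and sub: "S' \<subseteq> S" "T' \<subseteq> T"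
    using conjunct1[OF P] by simp_all
  note agree = conjunct1[OF conjunct2[OF P]] conjunct1[OF conjunct2[OF conjunct2[OF P]]]
  and closed = conjunct2[OF conjunct2[OF conjunct2[OF P]]]
  obtain b c where bc: "b \<in> S'" "c \<in> T'" using ne by blast
  have "b' = b \<and> c' = c" if "b' \<in> S" "c' \<in> T" "b' + c' = b + c" for b' c'
  proof -
    have *: "b' \<in> S'" "c' \<in> T'" using closed bc that by blast+
    have "lk b' x = lk b x" for x using agree(1) * bc by blast
    moreover have "lk c' x = lk c x" for x using agree(2) * bc by blast
    ultimately show ?thesis by (simp add: poly_mapping_eq_iff fun_eq_iff)
  qed
  then show ?thesis using bc sub by blast
qed

section \<open>Powers of an ideal of variables, spanned by the exponents of bounded part degree, are
  primary\<close>

definition part_degree :: "'v set \<Rightarrow> ('v \<Rightarrow>\<^sub>0 nat) \<Rightarrow> nat" where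
  "part_degree A b = (\<Sum>v\<in>A. lk b v)"

lemma part_degree_add: "part_degree A (b + c) = part_degree A b + part_degree A c"
  by (simp add: part_degree_def lookup_add sum.distrib)

lemma var_exponents_part_degree: "b \<in> var_exponents A \<longleftrightarrow> 0 < part_degree (A :: 'v::finite set) b"
proof -
  have "0 < part_degree A b \<longleftrightarrow> \<not> (\<forall>v\<in>A. lk b v = 0)"
    using sum_eq_0_iff[of A "lk b"] unfolding part_degree_def neq0_conv[symmetric] by simp
  then show ?thesis by (simp add: var_exponents_def)
qed

text \<open>Take the terms of \<open>f\<close> of lowest part degree d and the terms of
  \<open>w\<close> of part degree 0, which exist as \<open>w\<close> is not in
  \<open>var_ideal A\<close>. A sum attained only once among them is an exponent of
  \<open>w * f\<close> of part degree d, so d < k is impossible.\<close>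

lemma var_ideal_power_primary:
  fixes f w :: "('v::finite, 'k::field) mpoly"
  assumes wf: "w * f \<in> mono_ideal {b. k \<le> part_degree A b}" and w: "w \<notin> var_ideal A"
  shows "f \<in> mono_ideal {b. k \<le> part_degree A b}"
proof (rule ccontr)
  assume f: "f \<notin> mono_ideal {b. k \<le> part_degree A b}"
  define d where "d = Min (part_degree A ` Poly_Mapping.keys f)"
  define S where "S = {b \<in> Poly_Mapping.keys f. part_degree A b = d}"
  define T where "T = {c \<in> Poly_Mapping.keys w. part_degree A c = 0}"
  have "\<exists>b0\<in>Poly_Mapping.keys f. part_degree A b0 < k"
    using f by (simp add: mono_ideal_def subset_iff Bex_def not_le)
  then obtain b0 where b0: "b0 \<in> Poly_Mapping.keys f" "part_degree A b0 < k" by blast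
  have d_le: "d \<le> part_degree A b" if "b \<in> Poly_Mapping.keys f" for b
    unfolding d_def using that by simp
  have dk: "d < k" using d_le[OF b0(1)] b0(2) by simp
  have "d \<in> part_degree A ` Poly_Mapping.keys f" unfolding d_def using b0 by (intro Min_in) auto
  then have S: "S \<noteq> {}" by (auto simp: S_def)
  have T: "T \<noteq> {}"
    using w by (auto simp: T_def var_ideal_def mono_ideal_def var_exponents_part_degree)
  have "finite S" "finite T" by (simp_all add: S_def T_def)
  from unique_sum_pair[OF this S T] obtain b c where b: "b \<in> S" and c: "c \<in> T"
    and "\<forall>b'\<in>S. \<forall>c'\<in>T. b' + c' = b + c \<longrightarrow> b' = b \<and> c' = c"
    by (elim bexE)
  then have uniq: "b' = b \<and> c' = c" if "b' \<in> S" "c' \<in> T" "b' + c' = b + c" for b' c'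
    using that by blast
  have deg: "part_degree A (b + c) = d" using b c by (simp add: S_def T_def part_degree_add)
  have "w * f = (\<Sum>b'\<in>Poly_Mapping.keys f. Poly_Mapping.single b' (lk f b')) * w"
    by (simp only: mpoly_expansion mult.commute)
  then have "lk (w * f) (b + c) = (\<Sum>b'\<in>Poly_Mapping.keys f. lk (Poly_Mapping.single b' (lk f b') * w) (b + c))"
    by (simp only: sum_distrib_right lookup_sum)
  also have "\<dots> = (\<Sum>b'\<in>Poly_Mapping.keys f. if b' = b then lk f b * lk w c else 0)"
  proof (rule sum.cong[OF refl])
    fix b' assume b': "b' \<in> Poly_Mapping.keys f"
    show "lk (Poly_Mapping.single b' (lk f b') * w) (b + c) = (if b' = b then lk f b * lk w c else 0)"
    proof (cases "b' = b")
      case True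
      then show ?thesis by (simp add: lookup_single_mult mono_dvd_add)
    next
      case False
      have "lk w (b + c - b') = 0" if dvd: "mono_dvd b' (b + c)"
      proof (rule ccontr)
        assume nz: "lk w (b + c - b') \<noteq> 0"
        have eq: "b' + (b + c - b') = b + c" by (rule mono_dvd_diff_add[OF dvd])
        have "part_degree A b' + part_degree A (b + c - b') = d"
          unfolding part_degree_add[symmetric] eq by (rule deg)
        then have "part_degree A b' = d" "part_degree A (b + c - b') = 0"
          using d_le[OF b'] by linarith+
        then have "b' \<in> S" "b + c - b' \<in> T"
          using b' nz by (simp_all add: S_def T_def in_keys_iff)
        from uniq[OF this eq] show False using False by blast
      qed
      then show ?thesis using False by (simp add: lookup_single_mult)
    qed
  qed
  also have "\<dots> = lk f b * lk w c" using b by (simp add: S_def)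
  also have "\<dots> \<noteq> 0" using b c by (auto simp: S_def T_def in_keys_iff)
  finally have "b + c \<in> Poly_Mapping.keys (w * f)" by (simp add: in_keys_iff)
  then have "k \<le> part_degree A (b + c)" using wf by (auto simp: mono_ideal_def)
  then show False using deg dk by simp
qed

lemma var_ideal_eq_part_degree:
  "var_ideal A = (mono_ideal {b. 1 \<le> part_degree (A :: 'v::finite set) b} :: ('v, 'k::field) mpoly set)"
  unfolding var_ideal_def
  by (rule arg_cong[of _ _ mono_ideal]) (auto simp: var_exponents_part_degree Suc_le_eq)

lemma one_notin_var_ideal: "1 \<notin> (var_ideal A :: ('v::finite, 'k::field) mpoly set)"
  by (simp add: var_ideal_def mono_ideal_def var_exponents_def)

lemma var_ideal_prime: "w * f \<in> var_ideal A \<Longrightarrow> w \<in> var_ideal A \<or> f \<in> (var_ideal A :: ('v::finite, 'k::field) mpoly set)"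
  using var_ideal_power_primary[of w f 1 A] unfolding var_ideal_eq_part_degree by blast

lemma primeideal_var_ideal: "primeideal (var_ideal A :: ('v::finite, 'k::field) mpoly set) mpoly_ring"
proof (rule primeidealI)
  show "ideal (var_ideal A :: ('v, 'k) mpoly set) mpoly_ring"
    by (simp add: ideal_iff_is_ideal var_ideal_is_ideal)
  show "carrier mpoly_ring \<noteq> (var_ideal A :: ('v, 'k) mpoly set)"
    using one_notin_var_ideal by auto
qed (use cring_mpoly_ring var_ideal_prime in auto)

section \<open>Minimal primes of the cover ideal\<close>

lemma cover_ideal_eq: "cover_ideal E = (\<Inter>e\<in>E. var_ideal e)"
  by (simp add: cover_ideal_def genideal_vars)

lemma cover_ideal_is_ideal: "is_ideal (cover_ideal E)"
  unfolding cover_ideal_eq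
  by (rule is_idealI) (simp_all add: ideal_zero ideal_add ideal_mult var_ideal_is_ideal)

text \<open>Otherwise each edge has a variable outside \<open>Q\<close>. The product of these
  variables lies in every edge ideal, hence in the cover ideal, but not in the prime
  \<open>Q\<close>.\<close>

lemma prime_over_cover_ideal:
  assumes Q: "primeideal Q mpoly_ring" and sub: "(cover_ideal E :: ('v::finite, 'k::field) mpoly set) \<subseteq> Q"
  shows "\<exists>e\<in>E. var_ideal e \<subseteq> Q"
proof (rule ccontr)
  interpret primeideal Q mpoly_ring by (rule Q)
  have iQ: "is_ideal Q" using ideal_axioms by (simp add: ideal_iff_is_ideal)
  assume "\<not> (\<exists>e\<in>E. var_ideal e \<subseteq> Q)"
  then have "\<exists>v\<in>e. mpoly_var v \<notin> Q" if "e \<in> E" for e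
    using that genideal_minimal[of Q "mpoly_var ` e"] ideal_axioms by (auto simp: genideal_vars)
  then obtain x where x: "\<And>e. e \<in> E \<Longrightarrow> x e \<in> e \<and> mpoly_var (x e) \<notin> Q" by metis
  have "(\<Prod>e\<in>F. mpoly_var (x e)) \<notin> Q" if "finite F" "F \<subseteq> E" for F
    using that
  proof (induction F)
    case empty
    show ?case using I_notcarr ideal_eq_UNIV[OF iQ] by auto
  next
    case (insert e F)
    then show ?case using I_prime[of "mpoly_var (x e)" "\<Prod>e\<in>F. mpoly_var (x e)"] x by auto
  qed
  then have "(\<Prod>e\<in>E. mpoly_var (x e)) \<notin> Q" using finite by blast
  moreover have "(\<Prod>e\<in>E. mpoly_var (x e)) \<in> (var_ideal e :: ('v, 'k) mpoly set)" if e: "e \<in> E" for e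
  proof -
    have "mpoly_var (x e) \<in> (var_ideal e :: ('v, 'k) mpoly set)"
      using x[OF e] by (auto simp: mpoly_var_eq var_ideal_def var_exponents_def)
    moreover have "(\<Prod>e\<in>E. mpoly_var (x e)) = mpoly_var (x e) * (\<Prod>e\<in>E - {e}. mpoly_var (x e) :: ('v, 'k) mpoly)"
      using e by (intro prod.remove) auto
    ultimately show ?thesis using ideal_mult_right[OF var_ideal_is_ideal] by simp
  qed
  then have "(\<Prod>e\<in>E. mpoly_var (x e)) \<in> (cover_ideal E :: ('v, 'k) mpoly set)"
    unfolding cover_ideal_eq by (rule INT_I)
  ultimately show False using sub by blast
qed

lemma var_ideal_subset_iff:
  "(var_ideal A :: ('v::finite, 'k::field) mpoly set) \<subseteq> var_ideal B \<longleftrightarrow> A \<subseteq> B"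
proof
  assume sub: "(var_ideal A :: ('v, 'k) mpoly set) \<subseteq> var_ideal B"
  show "A \<subseteq> B"
  proof
    fix v assume "v \<in> A"
    then have "mon (chi {v}) \<in> (var_ideal A :: ('v, 'k) mpoly set)"
      by (auto simp: var_ideal_def var_exponents_def)
    then have "mon (chi {v}) \<in> (var_ideal B :: ('v, 'k) mpoly set)" using sub by blast
    then show "v \<in> B" by (auto simp: var_ideal_def var_exponents_def split: if_splits)
  qed
next
  assume "A \<subseteq> B"
  then have "var_exponents A \<subseteq> var_exponents B" by (auto simp: var_exponents_def)
  then show "(var_ideal A :: ('v, 'k) mpoly set) \<subseteq> var_ideal B"
    unfolding var_ideal_def by (rule mono_ideal_mono)
qed

text \<open>All edges have two vertices, so no edge ideal contains another, and every prime over the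
  cover ideal contains one of them.\<close>

lemma minimal_primes_cover_ideal:
  assumes "simple_graph E"
  shows "minimal_primes mpoly_ring (cover_ideal E :: ('v::finite, 'k::field) mpoly set) = var_ideal ` E"
proof (intro equalityI subsetI)
  fix P assume "P \<in> minimal_primes mpoly_ring (cover_ideal E :: ('v, 'k) mpoly set)"
  then have P: "primeideal P mpoly_ring" "cover_ideal E \<subseteq> P"
    and min: "\<And>Q. primeideal Q mpoly_ring \<Longrightarrow> cover_ideal E \<subseteq> Q \<Longrightarrow> Q \<subseteq> P \<Longrightarrow> Q = P"
    by (auto simp: minimal_primes_def)
  obtain e where e: "e \<in> E" "var_ideal e \<subseteq> P" using prime_over_cover_ideal[OF P] by blast
  then have "var_ideal e = P" by (intro min primeideal_var_ideal) (auto simp: cover_ideal_eq)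
  then show "P \<in> var_ideal ` E" using e by blast
next
  fix P assume "P \<in> (var_ideal ` E :: ('v, 'k) mpoly set set)"
  then obtain e where e: "e \<in> E" "P = var_ideal e" by blast
  have "Q = P" if Q: "primeideal Q mpoly_ring" "cover_ideal E \<subseteq> Q" "Q \<subseteq> P" for Q
  proof -
    obtain e' where e': "e' \<in> E" "var_ideal e' \<subseteq> Q" using prime_over_cover_ideal[OF Q(1,2)] by blast
    then have "e' \<subseteq> e" using Q(3) e(2) var_ideal_subset_iff[of e' e, where 'k = 'k] by blast
    moreover have "card e' = 2" "card e = 2" using assms e e' by (auto simp: simple_graph_def)
    ultimately have "e' = e" by (simp add: card_subset_eq)
    then show ?thesis using e' e Q by blast
  qed
  then show "P \<in> minimal_primes mpoly_ring (cover_ideal E)"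
    using e primeideal_var_ideal[of e, where 'k = 'k] by (auto simp: minimal_primes_def cover_ideal_eq)
qed

section \<open>Kernels of localization and powers of the cover ideal\<close>

lemma localization_kernel_iff:
  assumes I: "is_ideal (I :: ('v::finite, 'k::field) mpoly set)"
    and one: "1 \<notin> P" and mult: "\<And>u v. u \<notin> P \<Longrightarrow> v \<notin> P \<Longrightarrow> u * v \<notin> P"
  shows "f \<in> localization_kernel mpoly_ring I P \<longleftrightarrow> (\<exists>w. w \<notin> P \<and> w * f \<in> I)"
proof -
  let ?U = "- P"
  have rel: "((residue I x, u), (residue I y, v)) \<in> frac_rel mpoly_ring (quot I) ?U \<longleftrightarrow>
      u \<notin> P \<and> v \<notin> P \<and> (\<exists>w. w \<notin> P \<and> w * (v * x) - w * (u * y) \<in> I)" for x u y v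
    by (auto simp: frac_rel_def quot_simps[OF I] residue_eq_iff[OF I])
  have carr: "p \<in> range (residue I)" if "(q, (p, v)) \<in> frac_rel mpoly_ring (quot I) ?U" for p q v
    using that by (auto simp: frac_rel_def quot_simps(1)[OF I])
  have "f \<in> localization_kernel mpoly_ring I P \<longleftrightarrow>
      frac_rel mpoly_ring (quot I) ?U `` {(residue I f, 1)} = frac_rel mpoly_ring (quot I) ?U `` {(residue I 0, 1)}"
    by (simp add: localization_kernel_def to_localization_def quot_simps[OF I] Compl_eq_Diff_UNIV)
  also have "\<dots> \<longleftrightarrow> (\<exists>w. w \<notin> P \<and> w * f \<in> I)"
  proof
    assume eq: "frac_rel mpoly_ring (quot I) ?U `` {(residue I f, 1)} = frac_rel mpoly_ring (quot I) ?U `` {(residue I 0, 1)}"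
    have "(residue I f, 1) \<in> frac_rel mpoly_ring (quot I) ?U `` {(residue I f, 1)}"
      using one ideal_zero[OF I] by (auto simp: rel)
    then have "((residue I 0, 1), (residue I f, 1)) \<in> frac_rel mpoly_ring (quot I) ?U"
      using eq by blast
    then obtain w where "w \<notin> P" "w * (1 * 0) - w * (1 * f) \<in> I" unfolding rel by blast
    then show "\<exists>w. w \<notin> P \<and> w * f \<in> I" using ideal_uminus[OF I, of "- (w * f)"] by auto
  next
    assume "\<exists>w. w \<notin> P \<and> w * f \<in> I"
    then obtain w where w: "w \<notin> P" "w * f \<in> I" by blast
    \<comment> \<open>If w' witnesses the equality for one numerator, then w w' does for the other,
      because w annihilates f modulo \<open>I\<close>.\<close>
    have iff: "((residue I f, 1), (residue I y, v)) \<in> frac_rel mpoly_ring (quot I) ?U \<longleftrightarrow>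
        ((residue I 0, 1), (residue I y, v)) \<in> frac_rel mpoly_ring (quot I) ?U" for y v
    proof -
      have diff: "(w * w') * (v * f) \<in> I" for w'
        using ideal_mult[OF I w(2), of "w' * v"] by (simp add: mult_ac)
      have "(\<exists>w'. w' \<notin> P \<and> w' * (v * f) - w' * y \<in> I) \<longleftrightarrow> (\<exists>w'. w' \<notin> P \<and> w' * y \<in> I)"
      proof
        assume "\<exists>w'. w' \<notin> P \<and> w' * (v * f) - w' * y \<in> I"
        then obtain w' where w': "w' \<notin> P" "w' * (v * f) - w' * y \<in> I" by blast
        have "(w * w') * (v * f) - w * (w' * (v * f) - w' * y) \<in> I"
          by (intro ideal_diff[OF I] diff ideal_mult[OF I] w')
        then have "(w * w') * y \<in> I" by (simp add: algebra_simps)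
        then show "\<exists>w'. w' \<notin> P \<and> w' * y \<in> I" using mult[OF w(1) w'(1)] by blast
      next
        assume "\<exists>w'. w' \<notin> P \<and> w' * y \<in> I"
        then obtain w' where w': "w' \<notin> P" "w' * y \<in> I" by blast
        have "(w * w') * (v * f) - w * (w' * y) \<in> I"
          by (intro ideal_diff[OF I] diff ideal_mult[OF I] w')
        then have "(w * w') * (v * f) - (w * w') * y \<in> I" by (simp add: mult.assoc)
        then show "\<exists>w'. w' \<notin> P \<and> w' * (v * f) - w' * y \<in> I" using mult[OF w(1) w'(1)] by blast
      qed
      moreover have "w' * (v * 0) - w' * (1 * y) \<in> I \<longleftrightarrow> w' * y \<in> I" for w'
        using ideal_uminus[OF I, of "w' * y"] ideal_uminus[OF I, of "- (w' * y)"] by auto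
      ultimately show ?thesis unfolding rel using one by simp
    qed
    have "((residue I f, 1), t) \<in> frac_rel mpoly_ring (quot I) ?U \<longleftrightarrow>
        ((residue I 0, 1), t) \<in> frac_rel mpoly_ring (quot I) ?U" for t
    proof -
      obtain p v where t: "t = (p, v)" by (cases t)
      show ?thesis
      proof (cases "p \<in> range (residue I)")
        case True
        then obtain y where "p = residue I y" by blast
        then show ?thesis using iff[of y v] t by simp
      next
        case False
        then show ?thesis using carr unfolding t by blast
      qed
    qed
    then show "frac_rel mpoly_ring (quot I) ?U `` {(residue I f, 1)} = frac_rel mpoly_ring (quot I) ?U `` {(residue I 0, 1)}"
      unfolding Image_singleton by (rule Collect_cong)
  qed
  finally show ?thesis .
qed

abbreviation ideal_power :: "('v, 'k::field) mpoly set \<Rightarrow> nat \<Rightarrow> ('v, 'k) mpoly set" where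
  "ideal_power I k \<equiv> I [^]\<^bsub>ideals_set mpoly_ring\<^esub> k"

lemma ideal_power_simps:
  "ideal_power I 0 = UNIV"
  "ideal_power I (Suc k) = ideal_prod mpoly_ring (ideal_power I k) I"
  by (simp_all add: nat_pow_def ideals_set_def)

lemma ideal_power_is_ideal:
  assumes "is_ideal (I :: ('v, 'k::field) mpoly set)"
  shows "is_ideal (ideal_power I k)"
proof (induction k)
  case 0
  show ?case by (simp only: ideal_power_simps is_ideal_UNIV)
next
  case (Suc k)
  interpret cring "mpoly_ring :: ('v, 'k) mpoly ring" by (rule cring_mpoly_ring)
  show ?case
    using ideal_prod_is_ideal[of "ideal_power I k" I] Suc assms
    unfolding ideal_power_simps ideal_iff_is_ideal by blast
qed

lemma ideal_power_subset:
  assumes "I \<subseteq> var_ideal A"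
  shows "ideal_power I k \<subseteq> (mono_ideal {b. k \<le> part_degree A b} :: ('v::finite, 'k::field) mpoly set)"
proof (induction k)
  case 0
  show ?case by (simp add: mono_ideal_def)
next
  case (Suc k)
  have up: "upclosed {b. Suc k \<le> part_degree A b}"
    by (auto simp: upclosed_def part_degree_add)
  show ?case
  proof
    fix s assume "s \<in> ideal_power I (Suc k)"
    then have "s \<in> ideal_prod mpoly_ring (ideal_power I k) I" by (simp only: ideal_power_simps)
    then show "s \<in> mono_ideal {b. Suc k \<le> part_degree A b}"
    proof (induction s rule: ideal_prod.induct)
      case (prod i j)
      have i: "i \<in> mono_ideal {b. k \<le> part_degree A b}" and j: "j \<in> var_ideal A"
        using prod Suc.IH assms by auto
      have "Suc k \<le> part_degree A b" if "b \<in> Poly_Mapping.keys (i * j)" for b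
      proof -
        obtain c d where cd: "b = c + d" "c \<in> Poly_Mapping.keys i" "d \<in> Poly_Mapping.keys j"
          using \<open>b \<in> Poly_Mapping.keys (i * j)\<close> keys_mult by blast
        then have "k \<le> part_degree A c" "0 < part_degree A d"
          using i j by (auto simp: mono_ideal_def var_ideal_def var_exponents_part_degree)
        then show ?thesis by (simp add: cd part_degree_add)
      qed
      then show ?case by (auto simp: mono_ideal_def)
    next
      case (sum s1 s2)
      then show ?case using ideal_add[OF mono_ideal_is_ideal[OF up]] by simp
    qed
  qed
qed

lemma mon_in_cover_ideal_power:
  assumes ij: "{i, j} \<in> E" "i \<noteq> j" and E: "simple_graph E"
    and b: "k \<le> lk b i + lk b j" "\<And>v. v \<notin> {i, j} \<Longrightarrow> k \<le> lk b v"
  shows "mon b \<in> ideal_power (cover_ideal E :: ('v::finite, 'k::field) mpoly set) k"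
  using b
proof (induction k arbitrary: b)
  case 0
  show ?case by (simp only: ideal_power_simps UNIV_I)
next
  case (Suc k)
  have "0 < lk b i \<or> 0 < lk b j" using Suc.prems(1) by linarith
  then obtain x where x: "x \<in> {i, j}" "0 < lk b x" by blast
  \<comment> \<open>The complement of {i, j} together with one endpoint is a vertex cover: an edge
    missing it would have at most one vertex. Splitting off such a cover lowers k by one; x is
    chosen with positive exponent.\<close>
  define u where "u = chi (insert x (- {i, j}))"
  have "0 < lk b v" if "v \<in> insert x (- {i, j})" for v
    using that x Suc.prems(2)[of v] by fastforce
  then have "mono_dvd u b"
    by (auto simp: u_def mono_dvd_def of_bool_def Suc_le_eq)
  then obtain d where d: "b = u + d" by (auto simp: mono_dvd_iff)
  have "mon d \<in> ideal_power (cover_ideal E :: ('v, 'k) mpoly set) k"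
  proof (rule Suc.IH)
    show "k \<le> lk d i + lk d j"
      using Suc.prems(1) x(1) ij(2) by (auto simp: d u_def lookup_add)
    show "k \<le> lk d v" if "v \<notin> {i, j}" for v
      using Suc.prems(2)[OF that] that by (auto simp: d u_def lookup_add)
  qed
  moreover have "mon u \<in> (cover_ideal E :: ('v, 'k) mpoly set)"
  proof -
    have "\<exists>v\<in>e. v \<in> insert x (- {i, j})" if e: "e \<in> E" for e
    proof (rule ccontr)
      assume "\<not> ?thesis"
      then have "e \<subseteq> {i, j} - {x}" by blast
      moreover have "card ({i, j} - {x}) \<le> 1" using x(1) ij(2) by auto
      ultimately have "card e \<le> 1" by (meson card_mono finite le_trans)
      then show False using E e by (auto simp: simple_graph_def)
    qed
    then show ?thesis
      by (fastforce simp: cover_ideal_eq var_ideal_def var_exponents_def u_def)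
  qed
  ultimately have "mon d \<otimes>\<^bsub>mpoly_ring\<^esub> mon u \<in> ideal_prod mpoly_ring (ideal_power (cover_ideal E :: ('v, 'k) mpoly set) k) (cover_ideal E)"
    by (rule ideal_prod.prod)
  then show ?case unfolding ideal_power_simps by (simp add: mult_single d add.commute)
qed

text \<open>A factor outside the prime can be cancelled by \<open>var_ideal_power_primary\<close>.
  Conversely, the product of the k-th powers of all variables off \<open>e\<close> avoids the prime
  and moves every monomial of part degree at least k into the ordinary power.\<close>

lemma localization_kernel_cover_ideal:
  assumes E: "simple_graph E" and e: "e \<in> E"
  shows "localization_kernel mpoly_ring (ideal_power (cover_ideal E) k) (var_ideal e) =
    (mono_ideal {b. k \<le> part_degree e b} :: ('v::finite, 'k::field) mpoly set)"
proof (intro equalityI subsetI)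
  let ?J = "cover_ideal E :: ('v, 'k) mpoly set"
  have kernel: "f \<in> localization_kernel mpoly_ring (ideal_power ?J k) (var_ideal e) \<longleftrightarrow>
      (\<exists>w. w \<notin> var_ideal e \<and> w * f \<in> ideal_power ?J k)" for f
    using var_ideal_prime
    by (intro localization_kernel_iff ideal_power_is_ideal cover_ideal_is_ideal one_notin_var_ideal) blast
  fix f :: "('v, 'k) mpoly"
  {
    assume "f \<in> localization_kernel mpoly_ring (ideal_power ?J k) (var_ideal e)"
    then obtain w where w: "w \<notin> var_ideal e" "w * f \<in> ideal_power ?J k" unfolding kernel by blast
    have "?J \<subseteq> var_ideal e" using e by (auto simp: cover_ideal_eq)
    then have "w * f \<in> mono_ideal {b. k \<le> part_degree e b}"
      using w(2) ideal_power_subset by blast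
    then show "f \<in> mono_ideal {b. k \<le> part_degree e b}"
      using w(1) by (rule var_ideal_power_primary)
  next
    assume f: "f \<in> mono_ideal {b. k \<le> part_degree e b}"
    obtain i j where ij: "e = {i, j}" "i \<noteq> j"
      using E e by (auto simp: simple_graph_def card_2_iff)
    define w where "w = expo (\<lambda>v. if v \<in> e then 0 else k)"
    have "mon w * f \<in> mono_ideal (Poly_Mapping.keys (mon w * f))" by (simp add: mono_ideal_def)
    also have "\<dots> \<subseteq> ideal_power ?J k"
    proof (rule mono_ideal_subset)
      show "is_ideal (ideal_power ?J k)" by (intro ideal_power_is_ideal cover_ideal_is_ideal)
      fix b assume "b \<in> Poly_Mapping.keys (mon w * f)"
      then obtain d where d: "d \<in> Poly_Mapping.keys f" "b = w + d" by (auto simp: keys_mon_mult)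
      then have "k \<le> part_degree e d" using f by (auto simp: mono_ideal_def)
      then show "mon b \<in> ideal_power ?J k"
        using ij e E
        by (intro mon_in_cover_ideal_power[of i j]) (auto simp: d(2) w_def lookup_add part_degree_def)
    qed
    finally have "mon w * f \<in> ideal_power ?J k" .
    moreover have "mon w \<notin> (var_ideal e :: ('v, 'k) mpoly set)"
      by (auto simp: var_ideal_def var_exponents_def w_def)
    ultimately show "f \<in> localization_kernel mpoly_ring (ideal_power ?J k) (var_ideal e)"
      unfolding kernel by blast
  }
qed

lemma symbolic_power_cover_ideal:
  assumes E: "simple_graph E"
  shows "symbolic_power mpoly_ring (cover_ideal E) k =
    (mono_ideal (cover_exponents E k (\<lambda>_. 0) {}) :: ('v::finite, 'k::field) mpoly set)"
proof -
  have pd: "part_degree {i, j} b = lk b i + lk b j" if "{i, j} \<in> E" for i j b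
    using simple_graph_no_loop[OF E that] by (simp add: part_degree_def)
  have "b \<in> cover_exponents E k (\<lambda>_. 0) {} \<longleftrightarrow> (\<forall>e\<in>E. k \<le> part_degree e b)" for b
  proof -
    have "b \<in> cover_exponents E k (\<lambda>_. 0) {} \<longleftrightarrow> (\<forall>i j. {i, j} \<in> E \<longrightarrow> k \<le> lk b i + lk b j)"
      by (simp add: cover_exponents_def var_exponents_def)
    also have "\<dots> \<longleftrightarrow> (\<forall>e\<in>E. k \<le> part_degree e b)"
    proof
      assume *: "\<forall>i j. {i, j} \<in> E \<longrightarrow> k \<le> lk b i + lk b j"
      show "\<forall>e\<in>E. k \<le> part_degree e b"
      proof
        fix e assume "e \<in> E"
        moreover then obtain i j where "e = {i, j}"
          using E by (auto simp: simple_graph_def card_2_iff)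
        ultimately show "k \<le> part_degree e b" using * pd by simp
      qed
    qed (use pd in fastforce)
    finally show ?thesis .
  qed
  then have "(\<Inter>e\<in>E. mono_ideal {b. k \<le> part_degree e b}) =
      (mono_ideal (cover_exponents E k (\<lambda>_. 0) {}) :: ('v, 'k) mpoly set)"
    by (auto simp: mono_ideal_def)
  moreover have "symbolic_power mpoly_ring (cover_ideal E) k =
      (\<Inter>e\<in>E. mono_ideal {b. k \<le> part_degree e b} :: ('v, 'k) mpoly set)"
    unfolding symbolic_power_def minimal_primes_cover_ideal[OF E]
    by (simp add: localization_kernel_cover_ideal[OF E])
  ultimately show ?thesis by simp
qed

section \<open>Depth\<close>

lemma ord_seq_edge: "ord_seq E a b r \<Longrightarrow> i \<in> {1..r} \<Longrightarrow> {a i, b i} \<in> E"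
  and ord_seq_le: "ord_seq E a b r \<Longrightarrow> i \<in> {1..r} \<Longrightarrow> j \<in> {1..r} \<Longrightarrow> {a i, b j} \<in> E \<Longrightarrow> i \<le> j"
  unfolding ord_seq_def by blast+

lemma ord_seq_independent:
  assumes "ord_seq E a b r" "i \<in> {1..r}" "j \<in> {1..r}"
  shows "{a i, a j} \<notin> E"
proof -
  have "{x, y} \<notin> E" if "x \<in> a ` {1..r}" "y \<in> a ` {1..r}" for x y
    using assms(1) that unfolding ord_seq_def independent_def by blast
  from this[of "a i" "a j"] show ?thesis using assms(2,3) by simp
qed

text \<open>If a i = a j, then a i b j and a j b i are edges, so i <= j and j <= i; likewise for b.
  If a i = b j, the edge a j b j would lie inside the independent set.\<close>

lemma ord_seq_distinct:
  assumes "ord_seq E a b r"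
  shows "inj_on a {1..r}" "inj_on b {1..r}"
    and "\<And>i j. i \<in> {1..r} \<Longrightarrow> j \<in> {1..r} \<Longrightarrow> a i \<noteq> b j"
proof -
  note e = ord_seq_edge[OF assms] and ord = ord_seq_le[OF assms] and ind = ord_seq_independent[OF assms]
  have "i = j" if ij: "i \<in> {1..r}" "j \<in> {1..r}" "a i = a j" for i j
  proof (rule antisym)
    show "i \<le> j" using e[OF ij(2)] ij(3) by (intro ord[OF ij(1,2)]) simp
    show "j \<le> i" using e[OF ij(1)] ij(3) by (intro ord[OF ij(2,1)]) simp
  qed
  then show "inj_on a {1..r}" by (rule inj_onI)
  have "i = j" if ij: "i \<in> {1..r}" "j \<in> {1..r}" "b i = b j" for i j
  proof (rule antisym)
    show "i \<le> j" using e[OF ij(1)] ij(3) by (intro ord[OF ij(1,2)]) simp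
    show "j \<le> i" using e[OF ij(2)] ij(3) by (intro ord[OF ij(2,1)]) simp
  qed
  then show "inj_on b {1..r}" by (rule inj_onI)
  show "a i \<noteq> b j" if "i \<in> {1..r}" "j \<in> {1..r}" for i j
    using e[OF that(2)] ind[OF that(2) that(1)] by auto
qed

lemma ord_seq_ordered_matching:
  assumes ab: "ord_seq E a b r" and r: "1 \<le> r"
  shows "ordered_matching E ((\<lambda>i. {a i, b i}) ` {1..r})" "card ((\<lambda>i. {a i, b i}) ` {1..r}) = r"
proof -
  note d = ord_seq_distinct[OF ab]
  have disj: "disjnt {a i, b i} {a j, b j}" if "i \<in> {1..r}" "j \<in> {1..r}" "i \<noteq> j" for i j
    using that d(3)[of i j] d(3)[of j i] inj_on_eq_iff[OF d(1)] inj_on_eq_iff[OF d(2)]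
    by (auto simp: disjnt_def)
  have inj: "inj_on (\<lambda>i. {a i, b i}) {1..r}"
  proof (rule inj_onI, rule ccontr)
    fix i j assume "i \<in> {1..r}" "j \<in> {1..r}" "{a i, b i} = {a j, b j}" "i \<noteq> j"
    then show False using disj[of i j] by (simp add: disjnt_def)
  qed
  then show "card ((\<lambda>i. {a i, b i}) ` {1..r}) = r" by (simp add: card_image)
  have "matching E ((\<lambda>i. {a i, b i}) ` {1..r})"
    unfolding matching_def
  proof
    show "(\<lambda>i. {a i, b i}) ` {1..r} \<subseteq> E" by (intro image_subsetI ord_seq_edge[OF ab])
    show "pairwise disjnt ((\<lambda>i. {a i, b i}) ` {1..r})"
      unfolding pairwise_def using disj by blast
  qed
  moreover have "indexes_matching ((\<lambda>i. {a i, b i}) ` {1..r}) a b r"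
    using inj by (simp add: indexes_matching_def bij_betw_def)
  moreover have "independent E (a ` {1..r})" using ab unfolding ord_seq_def by (elim conjE)
  moreover have "\<forall>i\<in>{1..r}. \<forall>j\<in>{1..r}. {a i, b j} \<in> E \<longrightarrow> i \<le> j"
    using ord_seq_le[OF ab] by blast
  moreover have "(\<lambda>i. {a i, b i}) ` {1..r} \<noteq> {}" using r by simp
  ultimately show "ordered_matching E ((\<lambda>i. {a i, b i}) ` {1..r})"
    unfolding ordered_matching_def by blast
qed

lemma depth_quot_eq:
  assumes I: "is_ideal I" "I \<subseteq> var_ideal UNIV"
    and upper: "\<And>fs. weakly_regular I fs \<Longrightarrow> set fs \<subseteq> var_ideal UNIV \<Longrightarrow> length fs \<le> t"
    and lower: "weakly_regular I fs" "set fs \<subseteq> var_ideal UNIV" "length fs = t"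
  shows "depth mpoly_ring graded_maximal_ideal (quot (I :: ('v::finite, 'k::field) mpoly set)) = enat t"
proof -
  have "1 \<notin> I" using I(2) one_notin_var_ideal by blast
  then have "residue I 1 \<noteq> \<zero>\<^bsub>quot I\<^esub>" by (simp add: quot_simps[OF I(1)] residue_eq_iff[OF I(1)])
  moreover have "residue I 1 \<in> carrier (quot I)" by (simp add: quot_simps[OF I(1)])
  ultimately have nonzero: "carrier (quot I) \<noteq> {\<zero>\<^bsub>quot I\<^esub>}" by auto
  have "foldl ideal_extend I fs \<subseteq> var_ideal UNIV"
    by (rule foldl_extend_least[OF var_ideal_is_ideal I(2) lower(2)])
  then have "foldl ideal_extend I fs \<noteq> UNIV" using one_notin_var_ideal by blast
  then have "regular_sequence mpoly_ring (quot I) fs"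
    using lower(1) by (simp add: regular_sequence_quot_iff[OF I(1)])
  then have "enat t \<le> (SUP fs\<in>{fs. regular_sequence mpoly_ring (quot I) fs \<and> set fs \<subseteq> var_ideal UNIV}. enat (length fs))"
    using lower by (intro SUP_upper2[of fs]) auto
  moreover have "(SUP fs\<in>{fs. regular_sequence mpoly_ring (quot I) fs \<and> set fs \<subseteq> var_ideal UNIV}. enat (length fs)) \<le> enat t"
    using upper by (intro SUP_least) (auto simp: regular_sequence_quot_iff[OF I(1)])
  ultimately show ?thesis
    using nonzero unfolding depth_def graded_maximal_ideal_eq by (simp add: antisym)
qed

text \<open>The weights \<open>r + 1 - (s + i)\<close> on \<open>u i\<close> and their complements to \<open>k - 1\<close> on \<open>w i\<close> leave exactly the
  edges of the \<open>s\<close>-ordered matching with total weight below \<open>k\<close>.\<close>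

lemma koszul_nontrivial_s_ordered:
  fixes u w :: "nat \<Rightarrow> 'v::finite" and E :: "'v set set"
  assumes uw: "ord_seq E u w r" and s: "1 \<le> s" "s \<le> r"
    and s_ord: "\<And>i j. i \<in> {1..r} \<Longrightarrow> j \<in> {1..r} \<Longrightarrow> {u i, w j} \<in> E \<Longrightarrow> i = j \<or> i + s \<le> j"
    and no_loop: "\<And>x. {x, x} \<notin> E"
    and k: "s = 1 \<and> 2 * r \<le> k + 1 \<or> 2 \<le> s \<and> 2 * r + 2 \<le> k + 2 * s"
  shows "koszul_nontrivial
    (\<lambda>v. mon (scaled_chi (if v \<in> u ` {1..r} \<union> w ` {1..r} then 1 else Suc k) v) :: ('v, 'k::field) mpoly)
    (mono_ideal (cover_exponents E k (\<lambda>_. 0) {})) (card (UNIV :: 'v set) - r - 1)"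
proof -
  note d = ord_seq_distinct[OF uw]
  define A where "A i = (r + 1) - (s + i)" for i
  define f where "f v = (if v \<in> u ` {1..r} then A (inv_into {1..r} u v)
    else if v \<in> w ` {1..r} then k - 1 - A (inv_into {1..r} w v) else k)" for v
  have fu: "f (u i) = A i" if "i \<in> {1..r}" for i
    unfolding f_def using that by (simp only: imageI if_True inv_into_f_f[OF d(1) that])
  have fw: "f (w i) = k - 1 - A i" if i: "i \<in> {1..r}" for i
  proof -
    have "w i \<notin> u ` {1..r}" using d(3) i by force
    moreover have "w i \<in> w ` {1..r}" using i by (rule imageI)
    ultimately show ?thesis
      unfolding f_def by (simp only: if_True if_False inv_into_f_f[OF d(2) i])
  qed
  have Ak: "A i + 1 \<le> k" if "i \<in> {1..r}" for i
    using that k s unfolding A_def atLeastAtMost_iff by linarith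
  \<comment> \<open>This gives an edge between \<open>w i\<close> and \<open>w j\<close> total
    weight at least k, and the bound on k comes from here. The two largest weights are r - s and r -
    s - 1, whence 2 r - 2 s + 1 <= k; for r = s both are truncated to 0 and the condition is 2 <=
    k.\<close>
  have Aij: "A i + A j + 2 \<le> k" if "i \<in> {1..r}" "j \<in> {1..r}" "i \<noteq> j" for i j
    using that k s unfolding A_def atLeastAtMost_iff by linarith
  show ?thesis
  proof (rule koszul_nontrivial_cover[where a = "expo f"])
    show "1 \<le> r" using s by simp
    show "{u i, w i} \<in> E" if "i \<in> {1..r}" for i
      by (rule ord_seq_edge[OF uw that])
    show "Suc (lk (expo f) (u i) + lk (expo f) (w i)) = k" if "i \<in> {1..r}" for i
      using Ak[OF that] by (simp add: fu[OF that] fw[OF that])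
    show "lk (expo f) v = k" if "v \<notin> u ` {1..r} \<union> w ` {1..r}" for v
      using that by (simp add: f_def)
    show "\<exists>i\<in>{1..r}. {p, q} = {u i, w i}"
      if pq: "{p, q} \<in> E" and "lk (expo f) p + lk (expo f) q < k" for p q
    proof -
      have lt: "f p + f q < k" using that(2) by simp
      have uw_case: "\<exists>i\<in>{1..r}. {x, y} = {u i, w i}"
        if "{x, y} \<in> E" "f x + f y < k" "x = u i" "y = w j" "i \<in> {1..r}" "j \<in> {1..r}" for x y i j
      proof -
        have "\<not> i + s \<le> j"
        proof
          assume "i + s \<le> j"
          \<comment> \<open>Since i <= r - s, \<open>A i\<close> is positive, so the inequality is
            strict even where \<open>A j\<close> is truncated to 0.\<close>
          then have "A j < A i" using that(5,6) s unfolding A_def atLeastAtMost_iff by linarith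
          then show False using that(2) Ak[OF that(6)] by (simp add: that(3,4) fu[OF that(5)] fw[OF that(6)])
        qed
        then have "i = j" using s_ord[of i j] that by blast
        then show ?thesis using that by blast
      qed
      have "p \<in> u ` {1..r} \<union> w ` {1..r}" "q \<in> u ` {1..r} \<union> w ` {1..r}"
        using lt by (auto simp: f_def split: if_splits)
      then consider (uu) i j where "p = u i" "q = u j" "i \<in> {1..r}" "j \<in> {1..r}"
        | (uw) i j where "p = u i" "q = w j" "i \<in> {1..r}" "j \<in> {1..r}"
        | (wu) i j where "q = u i" "p = w j" "i \<in> {1..r}" "j \<in> {1..r}"
        | (ww) i j where "p = w i" "q = w j" "i \<in> {1..r}" "j \<in> {1..r}"
        by blast
      then show ?thesis
      proof cases
        case uu
        then show ?thesis using ord_seq_independent[OF assms(1)] pq by blast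
      next
        case (uw i j)
        then show ?thesis using uw_case[of p q i j] pq lt by blast
      next
        case (wu i j)
        then have "{q, p} \<in> E" "f q + f p < k" using pq lt by (simp_all add: insert_commute add.commute)
        then show ?thesis using uw_case[of q p i j] wu by (metis insert_commute)
      next
        case (ww i j)
        then have "i \<noteq> j" using pq no_loop by auto
        then show ?thesis using Aij[OF ww(3,4)] lt by (simp add: ww fw[OF ww(3)] fw[OF ww(4)])
      qed
    qed
  qed (use d in auto)
qed

lemma esym_in_var_ideal:
  assumes "1 \<le> i"
  shows "esym i \<in> (var_ideal UNIV :: ('v::finite, 'k::field) mpoly set)"
  unfolding esym_def
proof (rule ideal_sum[OF var_ideal_is_ideal])
  fix A :: "'v set" assume "A \<in> {A. card A = i}"
  then have "A \<noteq> {}" using assms by auto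
  then show "mon (chi A) \<in> (var_ideal UNIV :: ('v, 'k) mpoly set)"
    by (auto simp: var_ideal_def var_exponents_def)
qed

lemma depth_symbolic_power_cover_ideal:
  fixes E :: "'v::finite set set"
  assumes E: "simple_graph E" and uw: "ord_seq E u w r" and s: "1 \<le> s" "s \<le> r"
    and s_ord: "\<And>i j. i \<in> {1..r} \<Longrightarrow> j \<in> {1..r} \<Longrightarrow> {u i, w j} \<in> E \<Longrightarrow> i = j \<or> i + s \<le> j"
    and k: "s = 1 \<and> 2 * r \<le> k + 1 \<or> 2 \<le> s \<and> 2 * r + 2 \<le> k + 2 * s"
    and max: "\<And>a b j. ord_seq E a b j \<Longrightarrow> j \<le> r"
  shows "depth mpoly_ring graded_maximal_ideal
    (quot (symbolic_power mpoly_ring (cover_ideal E :: ('v, 'k::field) mpoly set) k))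
    = enat (card (UNIV :: 'v set) - r - 1)"
proof -
  let ?I = "mono_ideal (cover_exponents E k (\<lambda>_. 0) {}) :: ('v, 'k) mpoly set"
  let ?t = "card (UNIV :: 'v set) - r - 1"
  note d = ord_seq_distinct[OF uw]
  have I: "is_ideal ?I" by (rule mono_ideal_is_ideal[OF upclosed_cover_exponents])
  have e: "{u 1, w 1} \<in> E" using s by (intro ord_seq_edge[OF uw]) simp
  have no_loop: "{x, x} \<notin> E" for x using simple_graph_no_loop[OF E, of x x] by blast
  have k1: "1 \<le> k" using k s by linarith
  \<comment> \<open>An edge and k >= 1 make the ideal proper, so the quotient is not the zero module
    of depth \<infinity>.\<close>
  have "cover_exponents E k (\<lambda>_. 0) {} \<subseteq> var_exponents UNIV"
  proof
    fix b assume "b \<in> cover_exponents E k (\<lambda>_. 0) {}"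
    then have "k \<le> lk b (u 1) + lk b (w 1)" using e by (simp add: cover_exponents_def var_exponents_def)
    then have "0 < lk b (u 1) \<or> 0 < lk b (w 1)" using k1 by linarith
    then show "b \<in> var_exponents UNIV" by (auto simp: var_exponents_def)
  qed
  then have sub: "?I \<subseteq> var_ideal UNIV" unfolding var_ideal_def by (rule mono_ideal_mono)
  \<comment> \<open>With r >= 1 this shows n >= r + 1, so that n - r - 1 involves no
    truncation.\<close>
  have "card (u ` {1..r} \<union> w ` {1..r}) = r + r"
    using d by (subst card_Un_disjoint) (auto simp: card_image)
  then have n: "r + r \<le> card (UNIV :: 'v set)"
    using card_mono[of UNIV "u ` {1..r} \<union> w ` {1..r}"] by simp
  have "depth mpoly_ring graded_maximal_ideal (quot ?I) = enat ?t"
  proof (rule depth_quot_eq[OF I sub])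
    fix fs :: "('v, 'k) mpoly list"
    assume fs: "weakly_regular ?I fs" "set fs \<subseteq> var_ideal UNIV"
    show "length fs \<le> ?t"
    proof (rule length_weakly_regular_le[OF I fs(1)])
      show "koszul_nontrivial
          (\<lambda>v. mon (scaled_chi (if v \<in> u ` {1..r} \<union> w ` {1..r} then 1 else Suc k) v)) ?I ?t"
        by (rule koszul_nontrivial_s_ordered[OF uw s s_ord no_loop k])
      show "\<exists>m g. f ^ m = (\<Sum>v\<in>UNIV. g v *
          mon (scaled_chi (if v \<in> u ` {1..r} \<union> w ` {1..r} then 1 else Suc k) v))" if "f \<in> set fs" for f
        using that fs(2) by (intro power_in_combinations[where N = "Suc k"]) auto
    qed
  next
    show "weakly_regular ?I (map esym [1..<Suc ?t])"
      using n s max by (intro weakly_regular_cover[OF E, where q = r]) auto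
    show "set (map esym [1..<Suc ?t]) \<subseteq> (var_ideal UNIV :: ('v, 'k) mpoly set)"
      using esym_in_var_ideal by auto
  qed (simp del: upt_Suc)
  then show ?thesis by (simp only: symbolic_power_cover_ideal[OF E])
qed

theorem theorem3p1:
  fixes E :: "'v::finite set set" and s :: nat
  assumes "simple_graph E"
    and "1 \<le> s"
    and "s_ord_match s E = ereal (real (ord_match E))"
    and "\<And>t. 1 \<le> t \<Longrightarrow> s_ord_match t E = ereal (real (ord_match E)) \<Longrightarrow> t \<le> s"
  shows
    "(s = 1 \<longrightarrow>
       (\<forall>k::nat. int k \<ge> 2 * int (ord_match E) - 1 \<longrightarrow>
          depth mpoly_ring graded_maximal_ideal
            (quot_module mpoly_ring
              (symbolic_power mpoly_ring (cover_ideal E :: ('v, 'k::field) mpoly set) k))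
          = enat (card (UNIV :: 'v set) - ord_match E - 1))) \<and>
     (s \<ge> 2 \<longrightarrow>
       (\<forall>k::nat. int k \<ge> 2 * int (ord_match E) - 2 * int s + 2 \<longrightarrow>
          depth mpoly_ring graded_maximal_ideal
            (quot_module mpoly_ring
              (symbolic_power mpoly_ring (cover_ideal E :: ('v, 'k::field) mpoly set) k))
          = enat (card (UNIV :: 'v set) - ord_match E - 1)))"
proof -
  define r where "r = ord_match E"
  \<comment> \<open>The right-hand side is a real number, which excludes the default value of
    \<open>s_ord_match\<close>.\<close>
  have ex: "\<exists>M. s_ordered_matching s E M"
    using assms(3) by (auto simp: s_ord_match_def split: if_splits)
  have set_eq: "{card M | M. P M} = card ` Collect P" for P :: "'v set set \<Rightarrow> bool" by auto
  have fin: "finite {card M | M. P M}" for P :: "'v set set \<Rightarrow> bool" unfolding set_eq by simp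
  have "Max {card M | M. s_ordered_matching s E M} = r"
    using assms(3) ex by (simp add: s_ord_match_def r_def)
  moreover have "Max {card M | M. s_ordered_matching s E M} \<in> {card M | M. s_ordered_matching s E M}"
    using ex by (intro Max_in fin) auto
  ultimately obtain M where M: "s_ordered_matching s E M" "card M = r" by auto
  then obtain u w r' where idx: "indexes_matching M u w r'" and s: "s \<le> r'"
    and ind: "independent E (u ` {1..r'})"
    and s_ord: "\<forall>i\<in>{1..r'}. \<forall>j\<in>{1..r'}. {u i, w j} \<in> E \<longrightarrow> i = j \<or> i + s \<le> j"
    and ME: "M \<subseteq> E"
    unfolding s_ordered_matching_def matching_def by blast
  have r': "r' = r"
    using bij_betw_same_card[OF idx[unfolded indexes_matching_def]] M(2) by simp
  have "{u i, w i} \<in> E" if "i \<in> {1..r}" for i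
  proof -
    have "M = (\<lambda>i. {u i, w i}) ` {1..r}"
      using idx by (simp add: indexes_matching_def bij_betw_def r')
    then show ?thesis using that ME by blast
  qed
  then have uw: "ord_seq E u w r"
    unfolding ord_seq_def
  proof (intro conjI ballI impI)
    show "independent E (u ` {1..r})" using ind unfolding r' .
    show "i \<le> j" if "i \<in> {1..r}" "j \<in> {1..r}" "{u i, w j} \<in> E" for i j
    proof -
      have "i = j \<or> i + s \<le> j" using s_ord that unfolding r' by blast
      then show ?thesis by linarith
    qed
  qed
  \<comment> \<open>The empty sequence has to be treated apart, since an ordered matching is
    nonempty.\<close>
  have max: "j \<le> r" if "ord_seq E a b j" for a b j
  proof (cases "j = 0")
    case False
    then have "j \<in> {card M | M. ordered_matching E M}"
      using ord_seq_ordered_matching[OF that] by force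
    then show ?thesis unfolding r_def ord_match_def by (intro Max_ge fin)
  qed simp
  have depth: "depth mpoly_ring graded_maximal_ideal
      (quot (symbolic_power mpoly_ring (cover_ideal E :: ('v, 'k) mpoly set) k)) = enat (card (UNIV :: 'v set) - r - 1)"
    if "s = 1 \<and> 2 * r \<le> k + 1 \<or> 2 \<le> s \<and> 2 * r + 2 \<le> k + 2 * s" for k
    using s_ord s unfolding r'
    by (intro depth_symbolic_power_cover_ideal[OF assms(1) uw assms(2) _ _ that max]) blast+
  show ?thesis
  proof (intro conjI impI allI)
    fix k :: nat
    assume "s = 1" "2 * int (ord_match E) - 1 \<le> int k"
    then show "depth mpoly_ring graded_maximal_ideal
        (quot (symbolic_power mpoly_ring (cover_ideal E :: ('v, 'k) mpoly set) k))
        = enat (card (UNIV :: 'v set) - ord_match E - 1)"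
      using depth[of k] by (simp add: r_def)
  next
    fix k :: nat
    assume "2 \<le> s" "2 * int (ord_match E) - 2 * int s + 2 \<le> int k"
    then show "depth mpoly_ring graded_maximal_ideal
        (quot (symbolic_power mpoly_ring (cover_ideal E :: ('v, 'k) mpoly set) k))
        = enat (card (UNIV :: 'v set) - ord_match E - 1)"
      using depth[of k] by (simp add: r_def)
  qed
qed


end
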